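(* Let $(Z,d)$ be a metric space, let $\{\mu_{i}\}_{i\in\mathbb{Z}_{\ge 0}}$ be a sequence in $\mathrm{W}_{1}(Z)$, and let $\mu\in \mathrm{W}_{1}(Z)$. Then the following statements are equivalent: (1) the sequence $\{\mu_{i}\}$ converges to $\mu$ in $(\mathrm{W}_{1}(Z),\mathrm{W}_{1}[d])$; (2) for every continuous function $f\colon Z\to\mathbb{R}$ belonging to $\mathrm{MeC}(Z,d)$, we have $\int_{Z}f\,d\mu_{i}\to\int_{Z}f\,d\mu$ as $i\to\infty$.
   Context: A Borel measure $\mu$ on a metrizable space $Z$ is Radon if for every Borel set $B\subseteq Z$ and every $\epsilon>0$ there is a compact set $K\subseteq B$ with $\mu(B\setminus K)<\epsilon$. $\mathcal{RP}(Z)$ is the set of Radon Borel probability measures on $Z$, and $\delta_{x}$ is the Dirac measure at $x$. For $\alpha,\beta\in\mathcal{RP}(Z)$, $\Pi(\alpha,\beta)$ is the set of $\pi\in\mathcal{RP}(Z\times Z)$ with $\pi(B\times Z)=\alpha(B)$ and $\pi(Z\times B)=\beta(B)$ for all Borel $B\subseteq Z$. For a metric $d$ generating the topology of $Z$, $\mathrm{W}_{1}[d](\alpha,\beta)=\inf_{\pi\in\Pi(\alpha,\beta)}\int_{Z\times Z}d(s,t)\,d\pi(s,t)\in[0,\infty]$. $\mathrm{W}_{1}(Z)$ (with respect to $d$) is the set of $\alpha\in\mathcal{RP}(Z)$ with $\mathrm{W}_{1}[d](\alpha,\delta_{p})<\infty$ for some (equivalently every) $p\in Z$. $\mathrm{MeC}(Z,d)$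 is the set of all functions $f\colon Z\to\mathbb{R}$ (not necessarily continuous) for which there exist $a,b\in(0,\infty)$ and $p\in Z$ with $|f(x)|\le a\,d(x,p)+b$ for all $x\in Z$. The metric space $(Z,d)$ is not assumed to be complete or separable. *)

theory Defs
  imports "HOL-Probability.Probability"
begin

text \<open>
  A metric space \<open>(Z, d)\<close> is a type of class \<^class>\<open>metric_space\<close>, with \<open>d\<close> its
  \<^const>\<open>dist\<close>; neither completeness nor separability is assumed.
\<close>

definition radon_measure :: "'a::metric_space measure \<Rightarrow> bool" where
  "radon_measure M \<longleftrightarrow> sets M = sets borel \<and>
     (\<forall>B\<in>sets borel. \<forall>e>0::real. \<exists>K\<subseteq>B. compact K \<and> emeasure M (B - K) < ennreal e)"

definition radon_probs :: "'a::metric_space measure set" where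
  "radon_probs = {M. prob_space M \<and> radon_measure M}"

text \<open>
  Couplings are measures on the Borel sigma-algebra of the product topology. For nonseparable
  \<open>Z\<close> this can be strictly larger than the product sigma-algebra \<open>borel \<Otimes>\<^sub>M borel\<close>, which
  is why the latter is not used here.
\<close>

definition couplings ::
    "'a::metric_space measure \<Rightarrow> 'a measure \<Rightarrow> ('a \<times> 'a) measure set" where
  "couplings \<alpha> \<beta> = {\<pi> \<in> radon_probs. \<forall>B\<in>sets borel.
     emeasure \<pi> (B \<times> UNIV) = emeasure \<alpha> B \<and> emeasure \<pi> (UNIV \<times> B) = emeasure \<beta> B}"

definition W1_dist :: "'a::metric_space measure \<Rightarrow> 'a measure \<Rightarrow> ennreal" where
  "W1_dist \<alpha> \<beta> = (INF \<pi>\<in>couplings \<alpha> \<beta>. \<integral>\<^sup>+z. ennreal (dist (fst z) (snd z)) \<partial>\<pi>)"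

text \<open>The measure \<open>return borel p\<close> is the Dirac measure at \<open>p\<close>.\<close>

definition W1_space :: "'a::metric_space measure set" where
  "W1_space = {\<alpha> \<in> radon_probs. \<exists>p. W1_dist \<alpha> (return borel p) < \<infinity>}"

definition MeC :: "('a::metric_space \<Rightarrow> real) set" where
  "MeC = {f. \<exists>a>0. \<exists>b>0. \<exists>p. \<forall>x. \<bar>f x\<bar> \<le> a * dist x p + b}"

text \<open>
  Convergence in the metric space \<open>(W1_space, W1_dist)\<close>; the distance takes values in
  \<^typ>\<open>ennreal\<close>, and its convergence to 0 is meant there.
\<close>

definition W1_converges ::
    "(nat \<Rightarrow> 'a::metric_space measure) \<Rightarrow> 'a measure \<Rightarrow> bool" where
  "W1_converges \<mu> \<nu> \<longleftrightarrow> (\<lambda>i. W1_dist (\<mu> i) \<nu>) \<longlonglongrightarrow> 0"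

end

theory Submission imports Defs begin

text \<open>
  If (1) holds, take near-optimal couplings \<open>\<pi>\<close> of \<open>\<mu> i\<close> and \<open>\<nu>\<close>. A continuous \<open>f\<close> of linear
  growth satisfies \<open>\<bar>f x - f y\<bar> \<le> \<epsilon> + C d(x, y) + 1\<^bsub>Z - K\<^esub>(y) g(y)\<close>, where \<open>K\<close> is compact, \<open>C\<close> depends on
  \<open>\<epsilon>\<close> and \<open>K\<close>, and \<open>g(y) = 2 (a d(y, p) + b)\<close>. The integral of the last term against \<open>\<pi>\<close> depends
  on \<open>\<nu>\<close> only and is small when \<open>K\<close> is large.

  If (2) holds, no duality is needed: a coupling is written down. Let \<open>\<phi>\<^sub>1, \<dots>, \<phi>\<^sub>n\<close> be continuous
  functions of small support whose sum is at most 1, and equal to 1 on a large compact set. With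
  \<open>a\<^sub>k = \<integral>\<phi>\<^sub>k d\<alpha>\<close>, \<open>b\<^sub>k = \<integral>\<phi>\<^sub>k d\<beta>\<close>, \<open>m\<^sub>k = min a\<^sub>k b\<^sub>k\<close>, \<open>u = \<Sum>\<^sub>k (m\<^sub>k/a\<^sub>k) \<phi>\<^sub>k\<close> and
  \<open>v = \<Sum>\<^sub>k (m\<^sub>k/b\<^sub>k) \<phi>\<^sub>k\<close>, the density
  \<open>\<Sum>\<^sub>k m\<^sub>k/(a\<^sub>k b\<^sub>k) \<phi>\<^sub>k(x) \<phi>\<^sub>k(y) + (1 - u(x)) (1 - v(y)) / (1 - \<Sum>\<^sub>k m\<^sub>k)\<close>
  with respect to \<open>\<alpha> \<otimes> \<beta>\<close> defines a coupling. The first part moves mass over small distances only; the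
  cost of the second is controlled by \<open>\<bar>a\<^sub>k - b\<^sub>k\<bar>\<close> and the integrals of \<open>(1 - \<Sum>\<^sub>k \<phi>\<^sub>k) d(\<cdot>, p)\<close>, and
  convergence of all these numbers is an instance of (2).
\<close>

section \<open>Radon measures\<close>

text \<open>The sets with such approximations form a sigma-algebra, so closed sets suffice. A closed
  set is the intersection of its open metric neighbourhoods, whose measures converge because the
  measure is finite.\<close>

lemma finite_measure_closed_open_approx:
  fixes M :: "'a::metric_space measure"
  assumes fin: "finite_measure M" and sM: "sets M = sets borel"
    and B: "B \<in> sets borel" and e: "(e::real) > 0"
  shows "\<exists>C U. closed C \<and> open U \<and> C \<subseteq> B \<and> B \<subseteq> U \<and> measure M (U - C) < e"
proof -
  interpret finite_measure M by (rule fin)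
  have cl [measurable]: "C \<in> sets M" if "closed C" for C using that sM by simp
  have op [measurable]: "U \<in> sets M" if "open U" for U using that sM by simp
  let ?P = "\<lambda>B. \<forall>e>0. \<exists>C U. closed C \<and> open U \<and> C \<subseteq> B \<and> B \<subseteq> U \<and> measure M (U - C) < e"
  have "B \<in> sigma_sets UNIV (Collect closed)"
    using B by (simp add: borel_eq_closed)
  then have "?P B"
  proof induction
    case (Basic A)
    then have A: "closed A" by simp
    show ?case
    proof (intro allI impI)
      fix e :: real assume e: "e > 0"
      show "\<exists>C U. closed C \<and> open U \<and> C \<subseteq> A \<and> A \<subseteq> U \<and> measure M (U - C) < e"
      \<comment> \<open>\<open>infdist x {}\<close> is 0 by convention, so the neighbourhoods
        \<open>G n\<close> of the empty set would be the whole space.\<close>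
      proof (cases "A = {}")
        case True then show ?thesis using e by (intro exI[of _ "{}"]) auto
      next
        case False
        define G where "G n = {x. infdist x A < 1 / real (Suc n)}" for n
        have oG: "open (G n)" for n
          unfolding G_def by (intro open_Collect_less continuous_intros)
        have AG: "A \<subseteq> G n" for n by (auto simp: G_def)
        have dec: "decseq (\<lambda>n. G n - A)"
          unfolding decseq_def G_def
          by (auto intro: less_le_trans simp: frac_le)
        have "(\<Inter>n. G n - A) = {}"
        proof (rule ccontr)
          assume "(\<Inter>n. G n - A) \<noteq> {}"
          then obtain x where x: "\<And>n. infdist x A < 1 / real (Suc n)" "x \<notin> A"
            by (auto simp: G_def)
          then have "infdist x A > 0"
            using A False in_closed_iff_infdist_zero[of A x] infdist_nonneg[of x A] by force
          then obtain n where "inverse (real (Suc n)) < infdist x A"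
            using reals_Archimedean by blast
          with x(1)[of n] show False by (simp add: inverse_eq_divide)
        qed
        moreover have "(\<lambda>n. measure M (G n - A)) \<longlonglongrightarrow> measure M (\<Inter>n. G n - A)"
          using oG A dec by (intro finite_Lim_measure_decseq) auto
        ultimately have "(\<lambda>n. measure M (G n - A)) \<longlonglongrightarrow> 0" by (metis measure_empty)
        then have "\<forall>\<^sub>F n in sequentially. measure M (G n - A) < e"
          using e order_tendstoD(2) by blast
        then obtain n where "measure M (G n - A) < e"
          by (auto simp: eventually_sequentially)
        then show ?thesis using A oG AG by (intro exI[of _ A] exI[of _ "G n"]) simp
      qed
    qed
  next
    case Empty
    show ?case
      by (intro allI impI exI[of _ "{}"]) simp
  next
    case (Compl A)
    show ?case
    proof (intro allI impI)
      fix e :: real assume "e > 0"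
      then obtain C U where "closed C" "open U" "C \<subseteq> A" "A \<subseteq> U" "measure M (U - C) < e"
        using Compl.IH by meson
      moreover have "- C - - U = U - C" by auto
      ultimately show "\<exists>C U. closed C \<and> open U \<and> C \<subseteq> UNIV - A \<and> UNIV - A \<subseteq> U \<and> measure M (U - C) < e"
        by (intro exI[of _ "- U"] exI[of _ "- C"]) auto
    qed
  next
    case (Union A)
    show ?case
    proof (intro allI impI)
      fix e :: real assume e: "e > 0"
      \<comment> \<open>The errors add up to e / 2. The other half pays for truncating the union of
        the \<open>C n\<close>: only a finite union is sure to be closed.\<close>
      have "\<forall>n. \<exists>C U. closed C \<and> open U \<and> C \<subseteq> A n \<and> A n \<subseteq> U
              \<and> measure M (U - C) < e / 2 * (1/2) ^ Suc n"
        by (intro allI Union.IH[rule_format]) (use e in simp)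
      then obtain C U where CU: "\<And>n. closed (C n)" "\<And>n. open (U n)" "\<And>n. C n \<subseteq> A n"
          "\<And>n. A n \<subseteq> U n" "\<And>n. measure M (U n - C n) < e / 2 * (1/2) ^ Suc n"
        by metis
      let ?D = "\<lambda>n. (\<Union>i. C i) - (\<Union>i\<le>n. C i)"
      have Cs [measurable]: "C n \<in> sets M" "U n \<in> sets M" for n using CU by auto
      have s: "(\<lambda>n. e / 2 * (1/2) ^ Suc n) sums (e / 2)"
        using sums_mult[OF power_half_series, of "e / 2"] by simp
      have sm: "summable (\<lambda>n. measure M (U n - C n))"
        using less_imp_le[OF CU(5)]
        by (intro summable_comparison_test[OF _ sums_summable[OF s]] exI[of _ 0])
           (simp only: real_norm_def abs_of_nonneg measure_nonneg, blast)
      have "measure M (\<Union>n. U n - C n) \<le> (\<Sum>n. measure M (U n - C n))"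
        using sm by (intro finite_measure_subadditive_countably) auto
      also have "\<dots> \<le> e / 2"
        using suminf_le[OF _ sm sums_summable[OF s]] CU(5) sums_unique[OF s]
        by (metis less_imp_le)
      finally have 1: "measure M (\<Union>n. U n - C n) \<le> e / 2" .
      have "decseq ?D"
        unfolding decseq_def by (intro allI impI Diff_mono UN_mono) auto
      then have "(\<lambda>n. measure M (?D n)) \<longlonglongrightarrow> measure M (\<Inter>n. ?D n)"
        by (intro finite_Lim_measure_decseq) auto
      moreover have "(\<Inter>n. ?D n) = {}" by auto
      ultimately have "(\<lambda>n. measure M (?D n)) \<longlonglongrightarrow> 0" by (metis measure_empty)
      then have "\<forall>\<^sub>F n in sequentially. measure M (?D n) < e / 2"
        using e order_tendstoD(2)[of _ 0 _ "e/2"] by simp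
      then obtain n where 2: "measure M (?D n) < e / 2"
        by (auto simp: eventually_sequentially)
      have "measure M ((\<Union>i. U i) - (\<Union>i\<le>n. C i)) \<le> measure M ((\<Union>n. U n - C n) \<union> ?D n)"
        by (intro finite_measure_mono) auto
      also have "\<dots> \<le> measure M (\<Union>n. U n - C n) + measure M (?D n)"
        by (intro measure_Un_le) auto
      also have "\<dots> < e" using 1 2 by simp
      finally show "\<exists>C U. closed C \<and> open U \<and> C \<subseteq> \<Union> (range A) \<and> \<Union> (range A) \<subseteq> U \<and> measure M (U - C) < e"
        using CU(1,2) UN_mono[of "{..n}" UNIV C A] UN_mono[of UNIV UNIV A U] CU(3,4)
        by (intro exI[of _ "\<Union>i\<le>n. C i"] exI[of _ "\<Union>i. U i"] conjI closed_UN open_UN ballI) simp_all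
    qed
  qed
  then show ?thesis using e by blast
qed

text \<open>Compact sets that miss mass less than 1 / (n + 1) have a conull union; finite unions
  make them increase. A Radon measure thus lives on a \<sigma>-compact, hence separable,
  set.\<close>

lemma radon_measure_compact_exhaustion:
  fixes M :: "'a::metric_space measure"
  assumes "prob_space M" "radon_measure M"
  obtains K :: "nat \<Rightarrow> 'a set" where "\<And>n. compact (K n)" "incseq K" "AE x in M. x \<in> (\<Union>n. K n)"
proof -
  interpret prob_space M by fact
  have sM: "sets M = sets borel" using assms(2) by (simp add: radon_measure_def)
  then have space: "space M = UNIV" using sets_eq_imp_space_eq by fastforce
  have "\<forall>n. \<exists>K. compact K \<and> emeasure M (UNIV - K) < ennreal (1 / Suc n)"
    using assms(2) unfolding radon_measure_def
    by (metis of_nat_0_less_iff sets.top space_borel zero_less_Suc zero_less_divide_1_iff)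
  then obtain K where K: "\<And>n. compact (K n)" "\<And>n. emeasure M (UNIV - K n) < ennreal (1 / Suc n)"
    by metis
  have [measurable]: "K n \<in> sets M" for n
    using K(1) sM by (simp add: compact_imp_closed)
  have "emeasure M (UNIV - (\<Union>n. K n)) \<le> ennreal (1 / Suc n)" for n
    using K(2)[of n] by (intro order_trans[OF emeasure_mono less_imp_le[OF K(2)[of n]]])
      (auto simp: sM compact_imp_closed K(1))
  moreover have "(\<lambda>n. ennreal (1 / Suc n)) \<longlonglongrightarrow> ennreal 0"
    by (intro tendsto_ennrealI LIMSEQ_Suc[OF lim_1_over_n])
  ultimately have "emeasure M (UNIV - (\<Union>n. K n)) \<le> 0"
    by (intro LIMSEQ_le_const[of _ 0]) auto
  then have "AE x in M. x \<in> (\<Union>n. K n)"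
    by (intro AE_I[of _ _ "UNIV - (\<Union>n. K n)"]) (auto simp: space sM K(1) compact_imp_closed)
  then have "AE x in M. x \<in> (\<Union>n. \<Union>i\<le>n. K i)"
    by eventually_elim auto
  moreover have "incseq (\<lambda>n. \<Union>i\<le>n. K i)"
    unfolding incseq_def by (intro allI impI UN_mono) auto
  ultimately show thesis
    using K(1) by (intro that[of "\<lambda>n. \<Union>i\<le>n. K i"]) auto
qed

text \<open>The converse of the exhaustion, used to recognise couplings as Radon. For closed
  \<open>C\<close> inside \<open>B\<close> the set \<open>C \<inter> K n\<close> is compact, and it
  loses at most the mass of \<open>U - C\<close> and the mass outside \<open>K n\<close>.\<close>

lemma radon_measureI_sigma_compact:
  fixes M :: "'a::metric_space measure"
  assumes fin: "finite_measure M" and sM: "sets M = sets borel"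
    and K: "\<And>n::nat. compact (K n)" "incseq K" and AE: "AE x in M. x \<in> (\<Union>n. K n)"
  shows "radon_measure M"
  unfolding radon_measure_def
proof (intro conjI ballI allI impI sM)
  fix B :: "'a set" and e :: real assume B: "B \<in> sets borel" and e: "e > 0"
  interpret finite_measure M by (rule fin)
  have space: "space M = UNIV" using sM sets_eq_imp_space_eq by fastforce
  have Ks [measurable]: "K n \<in> sets M" "UNIV - K n \<in> sets M" for n
    using K(1) sM by (auto simp: compact_imp_closed)
  obtain C U where CU: "closed C" "open U" "C \<subseteq> B" "B \<subseteq> U" "measure M (U - C) < e / 2"
    using finite_measure_closed_open_approx[OF fin sM B, of "e/2"] e by auto
  have [measurable]: "C \<in> sets M" "U \<in> sets M" "B \<in> sets M" using CU B sM by auto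
  have "(\<lambda>n. measure M (UNIV - K n)) \<longlonglongrightarrow> measure M (\<Inter>n. UNIV - K n)"
    using K(2) by (intro finite_Lim_measure_decseq) (auto simp: decseq_def incseq_def space[symmetric])
  moreover have "measure M (\<Inter>n. UNIV - K n) = 0"
    using AE by (intro measure_eq_0_null_sets)
      (auto simp: AE_iff_null_sets space[symmetric] intro!: AE_iff_null_sets[THEN iffD2])
  ultimately have "\<forall>\<^sub>F n in sequentially. measure M (UNIV - K n) < e / 2"
    using e order_tendstoD(2)[of _ 0 _ "e/2"] by simp
  then obtain n where n: "measure M (UNIV - K n) < e / 2"
    by (auto simp: eventually_sequentially)
  have "measure M (B - C \<inter> K n) \<le> measure M ((U - C) \<union> (UNIV - K n))"
    using CU by (intro finite_measure_mono) auto
  also have "\<dots> \<le> measure M (U - C) + measure M (UNIV - K n)"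
    by (intro measure_Un_le) (auto simp: space[symmetric])
  also have "\<dots> < e" using CU n by simp
  finally have "emeasure M (B - C \<inter> K n) < ennreal e"
    using e by (simp add: emeasure_eq_measure ennreal_lessI)
  then show "\<exists>K\<subseteq>B. compact K \<and> emeasure M (B - K) < ennreal e"
    using CU K(1) by (intro exI[of _ "C \<inter> K n"]) (auto intro: closed_Int_compact)
qed

section \<open>The Radon product of two measures\<close>

lemma fst_measurable_borel [measurable]:
  "fst \<in> borel \<rightarrow>\<^sub>M (borel :: 'a::topological_space measure)"
  by (intro borel_measurable_continuous_onI continuous_intros)

lemma snd_measurable_borel [measurable]:
  "snd \<in> borel \<rightarrow>\<^sub>M (borel :: 'a::topological_space measure)"
  by (intro borel_measurable_continuous_onI continuous_intros)

text \<open>The inclusion of the product sigma-algebra in the Borel one, in the form that transfers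
  measurability of integrands.\<close>

lemma measurable_ident_borel_pair:
  "(\<lambda>z. z) \<in> borel \<rightarrow>\<^sub>M (borel :: 'a::topological_space measure) \<Otimes>\<^sub>M (borel :: 'b::topological_space measure)"
  using measurable_Pair[OF fst_measurable_borel snd_measurable_borel] by simp

text \<open>
  On a product of \<open>\<sigma>\<close>-compact sets, which are separable, the two \<open>\<sigma>\<close>-algebras \<open>borel\<close> and
  \<open>borel \<Otimes>\<^sub>M borel\<close> agree. This is why the product of two Radon measures extends to \<open>borel\<close>.
\<close>

lemma open_Int_sigma_compact_Times_sets:
  fixes K :: "nat \<Rightarrow> 'a::metric_space set" and L :: "nat \<Rightarrow> 'b::metric_space set"
  assumes K: "\<And>n. compact (K n)" and L: "\<And>n. compact (L n)" and U: "open U"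
  shows "U \<inter> ((\<Union>n. K n) \<times> (\<Union>n. L n)) \<in> sets (borel \<Otimes>\<^sub>M borel)"
proof -
  have ex: "\<exists>D. countable D \<and> (\<forall>x\<in>(\<Union>n. C n). \<forall>n. \<exists>a\<in>D. dist a x < 1 / real (Suc n))"
    if C: "\<And>n. compact (C n)" for C :: "nat \<Rightarrow> 'c::metric_space set"
  proof -
    have "\<forall>m n. \<exists>k. finite k \<and> C m \<subseteq> (\<Union>x\<in>k. ball x (1 / real (Suc n)))"
      using C unfolding compact_eq_totally_bounded by simp
    then obtain k where k: "\<And>m n. finite (k m n)" "\<And>m n. C m \<subseteq> (\<Union>x\<in>k m n. ball x (1 / real (Suc n)))"
      by metis
    show ?thesis
    proof (intro exI[of _ "\<Union>m n. k m n"] conjI ballI allI)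
      show "countable (\<Union>m n. k m n)" by (simp add: countable_finite k(1))
      fix x n assume "x \<in> (\<Union>n. C n)"
      then obtain m where "x \<in> C m" by auto
      then show "\<exists>a\<in>(\<Union>m n. k m n). dist a x < 1 / real (Suc n)" using k(2)[of m n] by fastforce
    qed
  qed
  obtain D where D: "countable D" "\<forall>x\<in>(\<Union>n. K n). \<forall>n. \<exists>a\<in>D. dist a x < 1 / real (Suc n)"
    using ex[of K, OF K] by (elim exE conjE)
  obtain E where E: "countable E" "\<forall>x\<in>(\<Union>n. L n). \<forall>n. \<exists>a\<in>E. dist a x < 1 / real (Suc n)"
    using ex[of L, OF L] by (elim exE conjE)
  \<comment> \<open>The countably many rectangles of balls inside \<open>U\<close> whose centres
    come from the two nets; on the \<sigma>-compact product they exhaust \<open>U\<close>.\<close>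
  define I where "I = {(a, b, n). a \<in> D \<and> b \<in> E \<and> ball a (1 / real (Suc n)) \<times> ball b (1 / real (Suc n)) \<subseteq> U}"
  have "countable I"
    by (rule countable_subset[of _ "D \<times> E \<times> UNIV"]) (use D E in \<open>auto simp: I_def\<close>)
  have "U \<inter> ((\<Union>n. K n) \<times> (\<Union>n. L n)) =
     (\<Union>(a, b, n)\<in>I. ball a (1 / real (Suc n)) \<times> ball b (1 / real (Suc n))) \<inter> ((\<Union>n. K n) \<times> (\<Union>n. L n))"
    (is "?l = ?r")
  proof
    show "?r \<subseteq> ?l" by (auto simp: I_def)
    show "?l \<subseteq> ?r"
    proof (rule subsetI)
      fix z assume z: "z \<in> ?l"
      obtain x y where xy: "z = (x, y)" by (cases z)
      obtain A B where AB: "open A" "open B" "x \<in> A" "y \<in> B" "A \<times> B \<subseteq> U"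
        using z xy U by (metis IntD1 open_prod_elim mem_Sigma_iff)
      obtain e where e: "e > 0" "ball x e \<subseteq> A" using AB openE by metis
      obtain e' where e': "e' > 0" "ball y e' \<subseteq> B" using AB openE by metis
      \<comment> \<open>The factor 1/2 is needed because a point of the ball about \<open>a\<close>
        may be almost 2 / (n + 1) away from \<open>x\<close>.\<close>
      obtain n where n: "inverse (real (Suc n)) < min e e' / 2"
        using reals_Archimedean[of "min e e' / 2"] e e' by auto
      obtain a where a: "a \<in> D" "dist a x < 1 / real (Suc n)" using D z xy by force
      obtain b where b: "b \<in> E" "dist b y < 1 / real (Suc n)" using E z xy by force
      have "ball a (1 / real (Suc n)) \<subseteq> ball x e"
      proof
        fix t assume "t \<in> ball a (1 / real (Suc n))"
        then show "t \<in> ball x e"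
          using a n dist_triangle[of x t a] by (auto simp: inverse_eq_divide dist_commute)
      qed
      moreover have "ball b (1 / real (Suc n)) \<subseteq> ball y e'"
      proof
        fix t assume "t \<in> ball b (1 / real (Suc n))"
        then show "t \<in> ball y e'"
          using b n dist_triangle[of y t b] by (auto simp: inverse_eq_divide dist_commute)
      qed
      ultimately have "ball a (1 / real (Suc n)) \<times> ball b (1 / real (Suc n)) \<subseteq> U"
        using e(2) e'(2) AB(5) by (meson Sigma_mono order_trans)
      then have "(a, b, n) \<in> I" using a b by (simp add: I_def)
      then show "z \<in> ?r" using a b xy z by (auto intro!: bexI[of _ "(a, b, n)"])
    qed
  qed
  also have "\<dots> \<in> sets (borel \<Otimes>\<^sub>M borel)"
    using \<open>countable I\<close> K L
    by (intro sets.Int sets.countable_UN' pair_measureI sets.countable_UN)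
       (auto simp: compact_imp_closed split: prod.splits)
  finally show ?thesis .
qed

text \<open>The identity need not be measurable from the product sigma-algebra to
  \<open>borel\<close>, but it becomes so after being made constant off the conull \<sigma>-compact
  set \<open>S\<close>. The image of the product measure under this map is \<open>P\<close>;
  integrals of product-measurable functions do not see the change.\<close>

lemma radon_product_exists:
  fixes \<alpha> :: "'a::metric_space measure" and \<beta> :: "'b::metric_space measure"
  assumes a: "\<alpha> \<in> radon_probs" and b: "\<beta> \<in> radon_probs"
  obtains P :: "('a \<times> 'b) measure" and K :: "nat \<Rightarrow> ('a \<times> 'b) set"
  where "prob_space P" "sets P = sets borel"
    "\<And>n. compact (K n)" "incseq K" "AE z in P. z \<in> (\<Union>n. K n)"
    "\<And>F. F \<in> borel_measurable (borel \<Otimes>\<^sub>M borel) \<Longrightarrow> (\<integral>\<^sup>+z. F z \<partial>P) = (\<integral>\<^sup>+z. F z \<partial>(\<alpha> \<Otimes>\<^sub>M \<beta>))"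
proof -
  interpret A: prob_space \<alpha> using a by (simp add: radon_probs_def)
  interpret B: prob_space \<beta> using b by (simp add: radon_probs_def)
  interpret AB: pair_prob_space \<alpha> \<beta> ..
  have sa [measurable_cong]: "sets \<alpha> = sets borel" and sb [measurable_cong]: "sets \<beta> = sets borel"
    using a b by (auto simp: radon_probs_def radon_measure_def)
  obtain K where K: "\<And>n. compact (K n)" "incseq K" "AE x in \<alpha>. x \<in> (\<Union>n. K n)"
    using a radon_measure_compact_exhaustion[of \<alpha>] by (auto simp: radon_probs_def)
  obtain L where L: "\<And>n. compact (L n)" "incseq L" "AE x in \<beta>. x \<in> (\<Union>n. L n)"
    using b radon_measure_compact_exhaustion[of \<beta>] by (auto simp: radon_probs_def)
  define S where "S = (\<Union>n. K n) \<times> (\<Union>n. L n)"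
  \<comment> \<open>Any constant serves off \<open>S\<close>; the preimage of an open
    \<open>U\<close> is then \<open>U \<inter> S\<close>, possibly with the complement of
    \<open>S\<close> added.\<close>
  define h where "h z = (if z \<in> S then z else undefined)" for z
  have spair: "sets (\<alpha> \<Otimes>\<^sub>M \<beta>) = sets (borel \<Otimes>\<^sub>M borel)" by (intro sets_pair_measure_cong sa sb)
  have sp: "space (\<alpha> \<Otimes>\<^sub>M \<beta>) = UNIV"
    using sets_eq_imp_space_eq[OF spair] by (simp add: space_pair_measure)
  have S: "S \<in> sets (\<alpha> \<Otimes>\<^sub>M \<beta>)"
    using open_Int_sigma_compact_Times_sets[OF K(1) L(1), of UNIV] by (simp add: S_def spair)
  have h [measurable]: "h \<in> \<alpha> \<Otimes>\<^sub>M \<beta> \<rightarrow>\<^sub>M borel"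
  proof (rule borel_measurableI)
    fix U :: "('a \<times> 'b) set" assume U: "open U"
    have "U \<inter> S \<in> sets (\<alpha> \<Otimes>\<^sub>M \<beta>)"
      using open_Int_sigma_compact_Times_sets[OF K(1) L(1) U] by (simp add: S_def spair)
    moreover have "h -` U \<inter> space (\<alpha> \<Otimes>\<^sub>M \<beta>)
        = (U \<inter> S) \<union> (if undefined \<in> U then space (\<alpha> \<Otimes>\<^sub>M \<beta>) - S else {})"
      by (intro set_eqI) (simp add: h_def sp)
    ultimately show "h -` U \<inter> space (\<alpha> \<Otimes>\<^sub>M \<beta>) \<in> sets (\<alpha> \<Otimes>\<^sub>M \<beta>)"
      using S by auto
  qed
  have AES: "AE z in \<alpha> \<Otimes>\<^sub>M \<beta>. z \<in> S"
  proof -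
    have "AE x in \<alpha>. AE y in \<beta>. (x, y) \<in> S"
      using K(3) by eventually_elim (use L(3) in eventually_elim, auto simp: S_def)
    then show ?thesis
      using S by (intro AB.AE_pair_measure) (auto simp: sp)
  qed
  define P where "P = distr (\<alpha> \<Otimes>\<^sub>M \<beta>) borel h"
  \<comment> \<open>Both exhaustions increase, so one common index is enough.\<close>
  have SK: "S = (\<Union>n. K n \<times> L n)"
  proof -
    have "\<exists>i. x \<in> K i \<and> y \<in> L i" if "x \<in> K m" "y \<in> L n" for x y m n
      using that K(2) L(2) unfolding incseq_def by (meson max.cobounded1 max.cobounded2 subsetD)
    then show ?thesis by (auto simp: S_def)
  qed
  show thesis
  proof
    show "prob_space P" unfolding P_def by (intro AB.prob_space_distr h)
    show "sets P = sets borel" by (simp add: P_def)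
    show "compact (K n \<times> L n)" for n using K L by (intro compact_Times)
    show "incseq (\<lambda>n. K n \<times> L n)" using K(2) L(2) by (simp add: incseq_def Sigma_mono)
    have Sb: "S \<in> sets borel" unfolding SK
      using K L by (intro sets.countable_UN) (auto intro!: borel_closed compact_imp_closed compact_Times)
    moreover have "AE z in \<alpha> \<Otimes>\<^sub>M \<beta>. h z \<in> S"
      using AES by eventually_elim (simp add: h_def)
    ultimately have "AE z in P. z \<in> S"
      unfolding P_def by (subst AE_distr_iff[OF h]) simp_all
    then show "AE z in P. z \<in> (\<Union>n. K n \<times> L n)" by (simp add: SK)
    fix F :: "'a \<times> 'b \<Rightarrow> ennreal" assume F: "F \<in> borel_measurable (borel \<Otimes>\<^sub>M borel)"
    have "F \<in> borel_measurable borel"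
      using measurable_compose[OF measurable_ident_borel_pair F] .
    then have "(\<integral>\<^sup>+z. F z \<partial>P) = (\<integral>\<^sup>+z. F (h z) \<partial>(\<alpha> \<Otimes>\<^sub>M \<beta>))"
      unfolding P_def by (intro nn_integral_distr h) simp
    also have "\<dots> = (\<integral>\<^sup>+z. F z \<partial>(\<alpha> \<Otimes>\<^sub>M \<beta>))"
      using AES by (intro nn_integral_cong_AE) (auto simp: h_def)
    finally show "(\<integral>\<^sup>+z. F z \<partial>P) = (\<integral>\<^sup>+z. F z \<partial>(\<alpha> \<Otimes>\<^sub>M \<beta>))" .
  qed
qed

section \<open>Couplings given by a density\<close>

text \<open>The coupling has density \<open>w\<close> with respect to the Radon product
  \<open>P\<close>: \<open>w1\<close> and \<open>w2\<close> give its marginals, and it is Radon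
  since it inherits the exhaustion of \<open>P\<close>. The majorant \<open>G\<close> appears
  because \<open>dist\<close> need not be product-measurable on a nonseparable space, whereas the
  passage from \<open>P\<close> to \<open>\<alpha> \<Otimes>\<^sub>M \<beta>\<close> requires a
  product-measurable integrand.\<close>

lemma W1_dist_le_density:
  fixes \<alpha> \<beta> :: "'a::metric_space measure" and w :: "'a \<Rightarrow> 'a \<Rightarrow> ennreal"
  assumes a: "\<alpha> \<in> radon_probs" and b: "\<beta> \<in> radon_probs"
    and w [measurable]: "(\<lambda>(x, y). w x y) \<in> borel_measurable (borel \<Otimes>\<^sub>M borel)"
    and w1: "AE x in \<alpha>. (\<integral>\<^sup>+y. w x y \<partial>\<beta>) = 1" and w2: "AE y in \<beta>. (\<integral>\<^sup>+x. w x y \<partial>\<alpha>) = 1"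
    and G [measurable]: "(\<lambda>(x, y). G x y) \<in> borel_measurable (borel \<Otimes>\<^sub>M borel)"
    and G_ge: "\<And>x y. ennreal (dist x y) * w x y \<le> G x y"
  shows "W1_dist \<alpha> \<beta> \<le> (\<integral>\<^sup>+x. \<integral>\<^sup>+y. G x y \<partial>\<beta> \<partial>\<alpha>)"
proof -
  interpret A: prob_space \<alpha> using a by (simp add: radon_probs_def)
  interpret B: prob_space \<beta> using b by (simp add: radon_probs_def)
  interpret AB: pair_prob_space \<alpha> \<beta> ..
  have sa [measurable_cong]: "sets \<alpha> = sets borel" and sb [measurable_cong]: "sets \<beta> = sets borel"
    using a b by (auto simp: radon_probs_def radon_measure_def)
  obtain P :: "('a \<times> 'a) measure" and K where P: "prob_space P" "sets P = sets borel"
    "\<And>n. compact (K n)" "incseq K" "AE z in P. z \<in> (\<Union>n. K n)"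
    "\<And>F. F \<in> borel_measurable (borel \<Otimes>\<^sub>M borel) \<Longrightarrow> (\<integral>\<^sup>+z. F z \<partial>P) = (\<integral>\<^sup>+z. F z \<partial>(\<alpha> \<Otimes>\<^sub>M \<beta>))"
    by (rule radon_product_exists[OF a b]) (rule that)
  note sP [measurable_cong] = P(2)
  define v where "v = (\<lambda>(x, y). w x y)"
  have v' [measurable]: "v \<in> borel_measurable (borel \<Otimes>\<^sub>M borel)"
    unfolding v_def by measurable
  have v [measurable]: "v \<in> borel_measurable borel"
    using measurable_compose[OF measurable_ident_borel_pair v'] .
  define \<pi> where "\<pi> = density P v"
  have s\<pi> [measurable_cong]: "sets \<pi> = sets borel" by (simp add: \<pi>_def P(2))
  have sp: "space \<alpha> = UNIV" "space \<beta> = UNIV" "space \<pi> = UNIV"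
    using sa[THEN sets_eq_imp_space_eq] sb[THEN sets_eq_imp_space_eq] s\<pi>[THEN sets_eq_imp_space_eq]
    by simp_all
  have fst_marg: "emeasure \<pi> (B \<times> UNIV) = emeasure \<alpha> B" if [measurable]: "B \<in> sets borel" for B
  proof -
    have [measurable]: "B \<times> UNIV \<in> sets (borel \<Otimes>\<^sub>M (borel::'a measure))" by auto
    have "B \<times> (UNIV::'a set) \<in> sets borel"
      using measurable_sets[OF fst_measurable_borel that]
      by (simp add: vimage_fst)
    then have "emeasure \<pi> (B \<times> UNIV) = (\<integral>\<^sup>+z. v z * indicator (B \<times> UNIV) z \<partial>P)"
      by (simp add: \<pi>_def emeasure_density P(2))
    also have "\<dots> = (\<integral>\<^sup>+z. v z * indicator (B \<times> UNIV) z \<partial>(\<alpha> \<Otimes>\<^sub>M \<beta>))"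
      by (intro P(6)) measurable
    also have "\<dots> = (\<integral>\<^sup>+x. \<integral>\<^sup>+y. w x y * indicator B x \<partial>\<beta> \<partial>\<alpha>)"
      by (subst B.nn_integral_fst[symmetric]) (auto simp: v_def indicator_def intro!: nn_integral_cong)
    also have "\<dots> = (\<integral>\<^sup>+x. indicator B x \<partial>\<alpha>)"
      using w1 by (intro nn_integral_cong_AE, elim AE_mp)
        (auto simp: nn_integral_multc intro!: AE_I2)
    finally show ?thesis by (simp add: sa)
  qed
  have snd_marg: "emeasure \<pi> (UNIV \<times> B) = emeasure \<beta> B" if [measurable]: "B \<in> sets borel" for B
  proof -
    have [measurable]: "UNIV \<times> B \<in> sets ((borel::'a measure) \<Otimes>\<^sub>M borel)" by auto
    have "(UNIV::'a set) \<times> B \<in> sets borel"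
      using measurable_sets[OF snd_measurable_borel that]
      by (simp add: vimage_snd)
    then have "emeasure \<pi> (UNIV \<times> B) = (\<integral>\<^sup>+z. v z * indicator (UNIV \<times> B) z \<partial>P)"
      by (simp add: \<pi>_def emeasure_density P(2))
    also have "\<dots> = (\<integral>\<^sup>+z. v z * indicator (UNIV \<times> B) z \<partial>(\<alpha> \<Otimes>\<^sub>M \<beta>))"
      by (intro P(6)) measurable
    also have "\<dots> = (\<integral>\<^sup>+y. \<integral>\<^sup>+x. w x y * indicator B y \<partial>\<alpha> \<partial>\<beta>)"
      by (subst AB.nn_integral_snd[symmetric]) (auto simp: v_def indicator_def intro!: nn_integral_cong)
    also have "\<dots> = (\<integral>\<^sup>+y. indicator B y \<partial>\<beta>)"
      using w2 by (intro nn_integral_cong_AE, elim AE_mp)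
        (auto simp: nn_integral_multc intro!: AE_I2)
    finally show ?thesis by (simp add: sb)
  qed
  have prob: "prob_space \<pi>"
    using fst_marg[of UNIV] A.emeasure_space_1 by (intro prob_spaceI) (simp add: sp)
  have "AE z in \<pi>. z \<in> (\<Union>n. K n)"
    unfolding \<pi>_def using P(5) by (subst AE_density) (measurable, auto)
  then have "radon_measure \<pi>"
    using prob_space.finite_measure[OF prob] s\<pi> P(3,4)
    by (intro radon_measureI_sigma_compact[of _ K]) auto
  then have "\<pi> \<in> couplings \<alpha> \<beta>"
    using prob fst_marg snd_marg by (auto simp: couplings_def radon_probs_def)
  then have "W1_dist \<alpha> \<beta> \<le> (\<integral>\<^sup>+z. ennreal (dist (fst z) (snd z)) \<partial>\<pi>)"
    unfolding W1_dist_def by (intro INF_lower)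
  also have "\<dots> = (\<integral>\<^sup>+z. v z * ennreal (dist (fst z) (snd z)) \<partial>P)"
    unfolding \<pi>_def
    by (intro nn_integral_density) (auto simp: measurable_cong_sets[OF sP refl]
         intro!: borel_measurable_continuous_onI continuous_intros measurable_compose[OF _ measurable_ennreal])
  also have "\<dots> \<le> (\<integral>\<^sup>+z. (\<lambda>(x, y). G x y) z \<partial>P)"
    using G_ge by (intro nn_integral_mono) (auto simp: v_def mult.commute split: prod.splits)
  also have "\<dots> = (\<integral>\<^sup>+z. (\<lambda>(x, y). G x y) z \<partial>(\<alpha> \<Otimes>\<^sub>M \<beta>))"
    by (intro P(6)) measurable
  also have "\<dots> = (\<integral>\<^sup>+x. \<integral>\<^sup>+y. G x y \<partial>\<beta> \<partial>\<alpha>)"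
    by (subst B.nn_integral_fst[symmetric]) auto
  finally show ?thesis .
qed

text \<open>\<open>D\<close> moves mass by at most \<open>e\<close>. Mass moved by \<open>L\<close>
  is charged the detour through \<open>p\<close>, so its cost depends on the marginals of
  \<open>L\<close> only, and the majorant is built from functions of one variable and the
  densities.\<close>

lemma W1_dist_le_split_density:
  fixes \<alpha> \<beta> :: "'a::metric_space measure" and D L :: "'a \<Rightarrow> 'a \<Rightarrow> ennreal"
  assumes a: "\<alpha> \<in> radon_probs" and b: "\<beta> \<in> radon_probs"
    and D [measurable]: "(\<lambda>(x, y). D x y) \<in> borel_measurable (borel \<Otimes>\<^sub>M borel)"
    and L [measurable]: "(\<lambda>(x, y). L x y) \<in> borel_measurable (borel \<Otimes>\<^sub>M borel)"
    and w1: "AE x in \<alpha>. (\<integral>\<^sup>+y. D x y + L x y \<partial>\<beta>) = 1"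
    and w2: "AE y in \<beta>. (\<integral>\<^sup>+x. D x y + L x y \<partial>\<alpha>) = 1"
    and D0: "\<And>x y. D x y \<noteq> 0 \<Longrightarrow> dist x y \<le> e" and e: "e \<ge> 0"
    and L1: "\<And>x. (\<integral>\<^sup>+y. L x y \<partial>\<beta>) \<le> l x"
    and L2: "\<And>y. (\<integral>\<^sup>+x. L x y \<partial>\<alpha>) \<le> m y"
  shows "W1_dist \<alpha> \<beta> \<le> ennreal e + (\<integral>\<^sup>+x. ennreal (dist x p) * l x \<partial>\<alpha>) + (\<integral>\<^sup>+y. ennreal (dist y p) * m y \<partial>\<beta>)"
proof -
  interpret A: prob_space \<alpha> using a by (simp add: radon_probs_def)
  interpret B: prob_space \<beta> using b by (simp add: radon_probs_def)
  interpret AB: pair_prob_space \<alpha> \<beta> ..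
  have sa [measurable_cong]: "sets \<alpha> = sets borel" and sb [measurable_cong]: "sets \<beta> = sets borel"
    using a b by (auto simp: radon_probs_def radon_measure_def)
  have [measurable]: "(\<lambda>x. ennreal (dist x p)) \<in> borel_measurable borel"
    by (intro measurable_compose[OF _ measurable_ennreal] borel_measurable_continuous_onI continuous_intros)
  \<comment> \<open>The factor of \<open>e\<close> is enlarged from \<open>D\<close> to
    \<open>D + L\<close>, whose inner integral is 1 almost everywhere.\<close>
  have "W1_dist \<alpha> \<beta> \<le> (\<integral>\<^sup>+x. \<integral>\<^sup>+y. (ennreal e * (D x y + L x y) + ennreal (dist x p) * L x y)
       + ennreal (dist y p) * L x y \<partial>\<beta> \<partial>\<alpha>)"
  proof (rule W1_dist_le_density[OF a b _ w1 w2])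
    fix x y
    have "ennreal (dist x y) * D x y \<le> ennreal e * D x y"
      using D0[of x y] by (cases "D x y = 0") (auto intro!: mult_right_mono ennreal_leI)
    moreover have "ennreal (dist x y) * L x y \<le> ennreal (dist x p) * L x y + ennreal (dist y p) * L x y"
      unfolding distrib_right[symmetric] ennreal_plus[OF zero_le_dist zero_le_dist, symmetric]
      by (intro mult_right_mono ennreal_leI dist_triangle2) simp
    ultimately have "ennreal (dist x y) * (D x y + L x y)
       \<le> ennreal e * D x y + (ennreal (dist x p) * L x y + ennreal (dist y p) * L x y)"
      by (simp add: distrib_left add_mono)
    also have "\<dots> \<le> (ennreal e * (D x y + L x y) + ennreal (dist x p) * L x y) + ennreal (dist y p) * L x y"
      by (simp add: distrib_left add.assoc add_mono add_increasing)
    finally show "ennreal (dist x y) * (D x y + L x y)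
       \<le> (ennreal e * (D x y + L x y) + ennreal (dist x p) * L x y) + ennreal (dist y p) * L x y" .
  qed measurable
  also have "\<dots> = (\<integral>\<^sup>+x. \<integral>\<^sup>+y. ennreal e * (D x y + L x y) \<partial>\<beta> \<partial>\<alpha>)
      + (\<integral>\<^sup>+x. \<integral>\<^sup>+y. ennreal (dist x p) * L x y \<partial>\<beta> \<partial>\<alpha>)
      + (\<integral>\<^sup>+x. \<integral>\<^sup>+y. ennreal (dist y p) * L x y \<partial>\<beta> \<partial>\<alpha>)"
    by (simp add: nn_integral_add)
  also have "(\<integral>\<^sup>+x. \<integral>\<^sup>+y. ennreal e * (D x y + L x y) \<partial>\<beta> \<partial>\<alpha>) = (\<integral>\<^sup>+x. ennreal e \<partial>\<alpha>)"
    using w1 by (intro nn_integral_cong_AE, elim AE_mp) (auto simp: nn_integral_cmult intro!: AE_I2)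
  also have "\<dots> = ennreal e" using A.emeasure_space_1 by simp
  also have "(\<integral>\<^sup>+x. \<integral>\<^sup>+y. ennreal (dist x p) * L x y \<partial>\<beta> \<partial>\<alpha>) \<le> (\<integral>\<^sup>+x. ennreal (dist x p) * l x \<partial>\<alpha>)"
    using L1 by (intro nn_integral_mono) (auto simp: nn_integral_cmult intro!: mult_left_mono)
  also have "(\<integral>\<^sup>+x. \<integral>\<^sup>+y. ennreal (dist y p) * L x y \<partial>\<beta> \<partial>\<alpha>)
      = (\<integral>\<^sup>+y. \<integral>\<^sup>+x. ennreal (dist y p) * L x y \<partial>\<alpha> \<partial>\<beta>)"
    by (rule AB.Fubini'[symmetric]) measurable
  also have "\<dots> \<le> (\<integral>\<^sup>+y. ennreal (dist y p) * m y \<partial>\<beta>)"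
    using L2 by (intro nn_integral_mono) (auto simp: nn_integral_cmult intro!: mult_left_mono)
  finally show ?thesis by (simp add: add_mono)
qed

section \<open>The coupling of a partition of unity\<close>

text \<open>The mass that both measures can spare on the patch \<open>\<phi> k\<close>, hence that
  can be transported within it.\<close>

definition overlap :: "'a measure \<Rightarrow> 'a measure \<Rightarrow> ('b \<Rightarrow> 'a \<Rightarrow> real) \<Rightarrow> 'b \<Rightarrow> real" where
  "overlap \<alpha> \<beta> \<phi> k = min (\<integral>x. \<phi> k x \<partial>\<alpha>) (\<integral>x. \<phi> k x \<partial>\<beta>)"

text \<open>
  In the next three definitions a vanishing denominator gives the value 0. This is harmless:
  \<open>overlap \<alpha> \<beta> \<phi> k\<close> vanishes with either integral, and if the overlaps sum to 1, then
  \<open>overlap_density \<alpha> \<beta> \<phi> X = 1\<close> almost everywhere, so that nothing is left over.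
\<close>

definition overlap_density ::
    "'a measure \<Rightarrow> 'a measure \<Rightarrow> ('b \<Rightarrow> 'a \<Rightarrow> real) \<Rightarrow> 'b set \<Rightarrow> 'a \<Rightarrow> real" where
  "overlap_density \<alpha> \<beta> \<phi> X x = (\<Sum>k\<in>X. overlap \<alpha> \<beta> \<phi> k / (\<integral>x. \<phi> k x \<partial>\<alpha>) * \<phi> k x)"

definition matched_density ::
    "'a measure \<Rightarrow> 'a measure \<Rightarrow> ('b \<Rightarrow> 'a \<Rightarrow> real) \<Rightarrow> 'b set \<Rightarrow> 'a \<Rightarrow> 'a \<Rightarrow> real" where
  "matched_density \<alpha> \<beta> \<phi> X x y =
     (\<Sum>k\<in>X. overlap \<alpha> \<beta> \<phi> k / ((\<integral>x. \<phi> k x \<partial>\<alpha>) * (\<integral>x. \<phi> k x \<partial>\<beta>)) * (\<phi> k x * \<phi> k y))"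

definition leftover_density ::
    "'a measure \<Rightarrow> 'a measure \<Rightarrow> ('b \<Rightarrow> 'a \<Rightarrow> real) \<Rightarrow> 'b set \<Rightarrow> 'a \<Rightarrow> 'a \<Rightarrow> real" where
  "leftover_density \<alpha> \<beta> \<phi> X x y =
     (1 - overlap_density \<alpha> \<beta> \<phi> X x) * (1 - overlap_density \<beta> \<alpha> \<phi> X y) / (1 - (\<Sum>k\<in>X. overlap \<alpha> \<beta> \<phi> k))"

lemma overlap_commute: "overlap \<alpha> \<beta> \<phi> k = overlap \<beta> \<alpha> \<phi> k"
  by (simp add: overlap_def min.commute)

lemma matched_density_commute: "matched_density \<alpha> \<beta> \<phi> X x y = matched_density \<beta> \<alpha> \<phi> X y x"
  by (simp add: matched_density_def overlap_commute[of \<alpha> \<beta>] mult.commute)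

lemma leftover_density_commute: "leftover_density \<alpha> \<beta> \<phi> X x y = leftover_density \<beta> \<alpha> \<phi> X y x"
  by (simp add: leftover_density_def overlap_commute[of \<alpha> \<beta>] mult.commute)

text \<open>Only a sum of at most 1 is required: finitely many small patches are available over a
  compact set, and what they miss counts as left over.\<close>

locale subpartition_of_unity =
  fixes X :: "'b set" and \<phi> :: "'b \<Rightarrow> 'a::topological_space \<Rightarrow> real"
  assumes finite: "finite X"
    and meas [measurable]: "\<And>k. k \<in> X \<Longrightarrow> \<phi> k \<in> borel_measurable borel"
    and nonneg: "\<And>k x. k \<in> X \<Longrightarrow> 0 \<le> \<phi> k x"
    and sum_le_1: "\<And>x. (\<Sum>k\<in>X. \<phi> k x) \<le> 1"
begin

lemma le_1: "k \<in> X \<Longrightarrow> \<phi> k x \<le> 1"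
  using member_le_sum[of k X "\<lambda>k. \<phi> k x"] sum_le_1[of x] nonneg finite by fastforce

section \<open>Bounds and total mass of the overlap density\<close>

context
  fixes \<alpha> \<beta> :: "'a measure"
  assumes \<alpha>: "prob_space \<alpha>" and s\<alpha> [measurable_cong]: "sets \<alpha> = sets borel"
    and \<beta>: "prob_space \<beta>" and s\<beta> [measurable_cong]: "sets \<beta> = sets borel"
begin

interpretation A: prob_space \<alpha> by (rule \<alpha>)
interpretation B: prob_space \<beta> by (rule \<beta>)

lemma integrable_part: "k \<in> X \<Longrightarrow> integrable \<alpha> (\<phi> k)"
  using le_1[of k] nonneg[of k] by (intro A.integrable_const_bound[of _ 1]) auto

lemma integral_part_nonneg: "k \<in> X \<Longrightarrow> 0 \<le> (\<integral>x. \<phi> k x \<partial>\<alpha>)" "k \<in> X \<Longrightarrow> 0 \<le> (\<integral>x. \<phi> k x \<partial>\<beta>)"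
  using nonneg[of k] by simp_all

lemma overlap_nonneg: "k \<in> X \<Longrightarrow> 0 \<le> overlap \<alpha> \<beta> \<phi> k"
  using integral_part_nonneg[of k] by (simp add: overlap_def)

text \<open>Vanishing integrals are covered: the overlap is the minimum of two nonnegative integrals
  and vanishes with either.\<close>

lemma overlap_quotient:
  assumes "k \<in> X"
  shows "0 \<le> overlap \<alpha> \<beta> \<phi> k / (\<integral>x. \<phi> k x \<partial>\<alpha>)" "overlap \<alpha> \<beta> \<phi> k / (\<integral>x. \<phi> k x \<partial>\<alpha>) \<le> 1"
    "overlap \<alpha> \<beta> \<phi> k / (\<integral>x. \<phi> k x \<partial>\<alpha>) * (\<integral>x. \<phi> k x \<partial>\<alpha>) = overlap \<alpha> \<beta> \<phi> k"
    "overlap \<alpha> \<beta> \<phi> k / ((\<integral>x. \<phi> k x \<partial>\<alpha>) * (\<integral>x. \<phi> k x \<partial>\<beta>)) * (\<integral>x. \<phi> k x \<partial>\<beta>)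
      = overlap \<alpha> \<beta> \<phi> k / (\<integral>x. \<phi> k x \<partial>\<alpha>)"
  using integral_part_nonneg[OF assms] by (auto simp: overlap_def divide_simps min_def)

lemma overlap_density_bounds: "0 \<le> overlap_density \<alpha> \<beta> \<phi> X x" "overlap_density \<alpha> \<beta> \<phi> X x \<le> 1"
proof -
  show "0 \<le> overlap_density \<alpha> \<beta> \<phi> X x"
    unfolding overlap_density_def by (intro sum_nonneg mult_nonneg_nonneg overlap_quotient nonneg)
  have "overlap_density \<alpha> \<beta> \<phi> X x \<le> (\<Sum>k\<in>X. \<phi> k x)"
    unfolding overlap_density_def by (intro sum_mono mult_left_le_one_le overlap_quotient nonneg)
  then show "overlap_density \<alpha> \<beta> \<phi> X x \<le> 1" using sum_le_1[of x] by simp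
qed

lemma overlap_density_measurable [measurable]: "overlap_density \<alpha> \<beta> \<phi> X \<in> borel_measurable borel"
  unfolding overlap_density_def by measurable

lemma integrable_overlap_density: "integrable \<alpha> (overlap_density \<alpha> \<beta> \<phi> X)"
  using overlap_density_bounds by (intro A.integrable_const_bound[of _ 1]) auto

lemma integral_overlap_density: "(\<integral>x. overlap_density \<alpha> \<beta> \<phi> X x \<partial>\<alpha>) = (\<Sum>k\<in>X. overlap \<alpha> \<beta> \<phi> k)"
proof -
  have "(\<integral>x. overlap_density \<alpha> \<beta> \<phi> X x \<partial>\<alpha>)
      = (\<Sum>k\<in>X. overlap \<alpha> \<beta> \<phi> k / (\<integral>x. \<phi> k x \<partial>\<alpha>) * (\<integral>x. \<phi> k x \<partial>\<alpha>))"
    unfolding overlap_density_def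
    by (subst Bochner_Integration.integral_sum) (intro integrable_mult_right integrable_part, auto)
  also have "\<dots> = (\<Sum>k\<in>X. overlap \<alpha> \<beta> \<phi> k)"
    by (intro sum.cong refl) (simp only: overlap_quotient(3))
  finally show ?thesis .
qed

lemma sum_overlap_le_1: "(\<Sum>k\<in>X. overlap \<alpha> \<beta> \<phi> k) \<le> 1"
proof -
  have "(\<integral>x. overlap_density \<alpha> \<beta> \<phi> X x \<partial>\<alpha>) \<le> (\<integral>x. 1 \<partial>\<alpha>)"
    using integrable_overlap_density overlap_density_bounds by (intro integral_mono) auto
  then show ?thesis by (simp add: integral_overlap_density A.prob_space)
qed

lemma matched_density_nonneg: "0 \<le> matched_density \<alpha> \<beta> \<phi> X x y"
  unfolding matched_density_def using integral_part_nonneg overlap_nonneg nonneg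
  by (intro sum_nonneg mult_nonneg_nonneg divide_nonneg_nonneg) auto

lemma matched_density_measurable [measurable]:
  "(\<lambda>(x, y). matched_density \<alpha> \<beta> \<phi> X x y) \<in> borel_measurable (borel \<Otimes>\<^sub>M borel)"
  unfolding matched_density_def by measurable

end

section \<open>Marginals of the matched and leftover densities\<close>

context
  fixes \<alpha> \<beta> :: "'a measure"
  assumes \<alpha>: "prob_space \<alpha>" and s\<alpha> [measurable_cong]: "sets \<alpha> = sets borel"
    and \<beta>: "prob_space \<beta>" and s\<beta> [measurable_cong]: "sets \<beta> = sets borel"
begin

interpretation A: prob_space \<alpha> by (rule \<alpha>)
interpretation B: prob_space \<beta> by (rule \<beta>)

text \<open>The facts of the preceding context are needed with the two measures in either order;
  these lists instantiate their hypotheses.\<close>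

lemmas AB = \<alpha> s\<alpha> \<beta> s\<beta>
lemmas BA = \<beta> s\<beta> \<alpha> s\<alpha>

lemma integrable_matched_density: "integrable \<beta> (matched_density \<alpha> \<beta> \<phi> X x)"
  unfolding matched_density_def
  by (intro Bochner_Integration.integrable_sum integrable_mult_right integrable_part[OF BA])

text \<open>Integrating out \<open>y\<close> replaces \<open>\<phi> k y\<close> by its
  \<beta>-integral, which cancels one factor of the denominator.\<close>

lemma integral_matched_density:
  "(\<integral>y. matched_density \<alpha> \<beta> \<phi> X x y \<partial>\<beta>) = overlap_density \<alpha> \<beta> \<phi> X x"
proof -
  have "(\<integral>y. matched_density \<alpha> \<beta> \<phi> X x y \<partial>\<beta>)
     = (\<Sum>k\<in>X. overlap \<alpha> \<beta> \<phi> k / ((\<integral>x. \<phi> k x \<partial>\<alpha>) * (\<integral>x. \<phi> k x \<partial>\<beta>)) * (\<phi> k x * (\<integral>x. \<phi> k x \<partial>\<beta>)))"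
    unfolding matched_density_def
    by (subst Bochner_Integration.integral_sum)
       (intro integrable_mult_right integrable_part[OF BA], auto)
  also have "\<dots> = (\<Sum>k\<in>X. overlap \<alpha> \<beta> \<phi> k / ((\<integral>x. \<phi> k x \<partial>\<alpha>) * (\<integral>x. \<phi> k x \<partial>\<beta>)) * (\<integral>x. \<phi> k x \<partial>\<beta>) * \<phi> k x)"
    by (simp only: ac_simps)
  also have "\<dots> = overlap_density \<alpha> \<beta> \<phi> X x"
    unfolding overlap_density_def by (intro sum.cong refl) (simp only: overlap_quotient(4)[OF AB])
  finally show ?thesis .
qed

lemma leftover_density_nonneg: "0 \<le> leftover_density \<alpha> \<beta> \<phi> X x y"
  unfolding leftover_density_def
  using overlap_density_bounds[OF AB] overlap_density_bounds[OF BA] sum_overlap_le_1[OF AB]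
  by (intro divide_nonneg_nonneg mult_nonneg_nonneg) auto

lemma leftover_density_measurable [measurable]:
  "(\<lambda>(x, y). leftover_density \<alpha> \<beta> \<phi> X x y) \<in> borel_measurable (borel \<Otimes>\<^sub>M borel)"
proof -
  note [measurable] = overlap_density_measurable[OF AB] overlap_density_measurable[OF BA]
  show ?thesis unfolding leftover_density_def by measurable
qed

lemma integrable_leftover_density: "integrable \<beta> (leftover_density \<alpha> \<beta> \<phi> X x)"
  unfolding leftover_density_def
  by (intro integrable_divide integrable_mult_right Bochner_Integration.integrable_diff
      integrable_overlap_density[OF BA]) simp

text \<open>The quotient stays uncancelled, since it is 0 and not 1 when the overlaps sum to
  1.\<close>

lemma integral_leftover_density:
  "(\<integral>y. leftover_density \<alpha> \<beta> \<phi> X x y \<partial>\<beta>) =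
     (1 - overlap_density \<alpha> \<beta> \<phi> X x) * (1 - (\<Sum>k\<in>X. overlap \<alpha> \<beta> \<phi> k)) / (1 - (\<Sum>k\<in>X. overlap \<alpha> \<beta> \<phi> k))"
  unfolding leftover_density_def using integrable_overlap_density[OF BA]
  by (simp add: integral_overlap_density[OF BA] overlap_commute[of \<beta> \<alpha>] B.prob_space)

text \<open>Equality holds unless the overlaps sum to 1; in that case the left side is 0.\<close>

lemma nn_integral_leftover_density:
  "(\<integral>\<^sup>+y. ennreal (leftover_density \<alpha> \<beta> \<phi> X x y) \<partial>\<beta>) \<le> ennreal (1 - overlap_density \<alpha> \<beta> \<phi> X x)"
proof -
  have "(\<integral>\<^sup>+y. ennreal (leftover_density \<alpha> \<beta> \<phi> X x y) \<partial>\<beta>)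
      = ennreal (\<integral>y. leftover_density \<alpha> \<beta> \<phi> X x y \<partial>\<beta>)"
    by (intro nn_integral_eq_integral integrable_leftover_density AE_I2 leftover_density_nonneg)
  also have "\<dots> \<le> ennreal (1 - overlap_density \<alpha> \<beta> \<phi> X x)"
    using overlap_density_bounds[OF AB, of x]
    by (intro ennreal_leI) (simp add: integral_leftover_density)
  finally show ?thesis .
qed

text \<open>The two parts contribute \<open>u x\<close> and \<open>1 - u x\<close>, where
  \<open>u\<close> is the overlap density. If the overlaps sum to 1, the second part is 0 instead,
  but then \<open>1 - u\<close> is nonnegative with integral 0, so \<open>u = 1\<close> almost
  everywhere.\<close>

lemma nn_integral_matched_leftover:
  "AE x in \<alpha>. (\<integral>\<^sup>+y. ennreal (matched_density \<alpha> \<beta> \<phi> X x y) + ennreal (leftover_density \<alpha> \<beta> \<phi> X x y) \<partial>\<beta>) = 1"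
proof -
  let ?u = "overlap_density \<alpha> \<beta> \<phi> X" and ?M = "\<Sum>k\<in>X. overlap \<alpha> \<beta> \<phi> k"
  have "AE x in \<alpha>. ?M \<noteq> 1 \<or> ?u x = 1"
  proof (cases "?M = 1")
    case True
    have "(\<integral>x. 1 - ?u x \<partial>\<alpha>) = 0"
      using integrable_overlap_density[OF AB] by (simp add: integral_overlap_density[OF AB] A.prob_space True)
    then have "AE x in \<alpha>. 1 - ?u x = 0"
      using overlap_density_bounds[OF AB] integrable_overlap_density[OF AB]
      by (subst (asm) integral_nonneg_eq_0_iff_AE) auto
    then show ?thesis by eventually_elim simp
  qed simp
  then show ?thesis
  proof eventually_elim
    case (elim x)
    have "(\<integral>\<^sup>+y. ennreal (matched_density \<alpha> \<beta> \<phi> X x y) + ennreal (leftover_density \<alpha> \<beta> \<phi> X x y) \<partial>\<beta>)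
       = (\<integral>\<^sup>+y. ennreal (matched_density \<alpha> \<beta> \<phi> X x y + leftover_density \<alpha> \<beta> \<phi> X x y) \<partial>\<beta>)"
      by (intro nn_integral_cong ennreal_plus[symmetric] matched_density_nonneg[OF AB] leftover_density_nonneg)
    also have "\<dots> = ennreal (\<integral>y. matched_density \<alpha> \<beta> \<phi> X x y + leftover_density \<alpha> \<beta> \<phi> X x y \<partial>\<beta>)"
      by (intro nn_integral_eq_integral AE_I2 add_nonneg_nonneg matched_density_nonneg[OF AB]
          leftover_density_nonneg Bochner_Integration.integrable_add
          integrable_matched_density integrable_leftover_density)
    also have "(\<integral>y. matched_density \<alpha> \<beta> \<phi> X x y + leftover_density \<alpha> \<beta> \<phi> X x y \<partial>\<beta>)
        = ?u x + (1 - ?u x) * (1 - ?M) / (1 - ?M)"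
      by (simp add: integrable_matched_density integrable_leftover_density
          integral_matched_density integral_leftover_density)
    also have "\<dots> = 1" using elim by auto
    finally show ?case by simp
  qed
qed

end

end

section \<open>Transport cost of the coupling\<close>

locale metric_subpartition_of_unity = subpartition_of_unity X \<phi>
  for X :: "'b set" and \<phi> :: "'b \<Rightarrow> 'a::metric_space \<Rightarrow> real" +
  fixes p :: 'a and R e :: real
  assumes e: "e \<ge> 0" and R: "R \<ge> 0"
    and support_dist: "\<And>k x. k \<in> X \<Longrightarrow> \<phi> k x \<noteq> 0 \<Longrightarrow> dist x p \<le> R"
    and support_diam: "\<And>k x y. k \<in> X \<Longrightarrow> \<phi> k x \<noteq> 0 \<Longrightarrow> \<phi> k y \<noteq> 0 \<Longrightarrow> dist x y \<le> e"
begin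

text \<open>With \<open>q k\<close> the overlap quotient, \<open>1 - u\<close> splits into
  \<open>1 - (\<Sum>k\<in>X. \<phi> k x)\<close> and the sum of the
  \<open>(1 - q k) * \<phi> k x\<close>. On the support of \<open>\<phi> k\<close> the distance to
  \<open>p\<close> is at most \<open>R\<close>, and the mass of the k-th term is its
  \<alpha>-integral minus the overlap, at most the difference of the two integrals in absolute
  value.\<close>

lemma nn_integral_dist_leftover_le:
  fixes \<alpha> \<beta> :: "'a measure"
  assumes \<alpha>: "prob_space \<alpha>" and s\<alpha>: "sets \<alpha> = sets borel"
    and \<beta>: "prob_space \<beta>" and s\<beta>: "sets \<beta> = sets borel"
    and int: "integrable \<alpha> (\<lambda>x. dist x p)"
  shows "(\<integral>\<^sup>+x. ennreal (dist x p) * ennreal (1 - overlap_density \<alpha> \<beta> \<phi> X x) \<partial>\<alpha>)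
    \<le> ennreal ((\<integral>x. (1 - (\<Sum>k\<in>X. \<phi> k x)) * dist x p \<partial>\<alpha>)
        + R * (\<Sum>k\<in>X. \<bar>(\<integral>x. \<phi> k x \<partial>\<alpha>) - (\<integral>x. \<phi> k x \<partial>\<beta>)\<bar>))"
proof -
  interpret A: prob_space \<alpha> by (rule \<alpha>)
  note AB = \<alpha> s\<alpha> \<beta> s\<beta>
  note [measurable_cong] = s\<alpha>
  let ?a = "\<lambda>k. \<integral>x. \<phi> k x \<partial>\<alpha>" and ?b = "\<lambda>k. \<integral>x. \<phi> k x \<partial>\<beta>"
  let ?q = "\<lambda>k. overlap \<alpha> \<beta> \<phi> k / ?a k"
  let ?g = "\<lambda>x. (1 - (\<Sum>k\<in>X. \<phi> k x)) * dist x p" and ?h = "\<lambda>x. \<Sum>k\<in>X. (1 - ?q k) * R * \<phi> k x"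
  have [measurable]: "(\<lambda>x. dist x p) \<in> borel_measurable borel"
    by (intro borel_measurable_continuous_onI continuous_intros)
  have pw: "dist x p * (1 - overlap_density \<alpha> \<beta> \<phi> X x) \<le> ?g x + ?h x" for x
  proof -
    have "1 - overlap_density \<alpha> \<beta> \<phi> X x = (1 - (\<Sum>k\<in>X. \<phi> k x)) + (\<Sum>k\<in>X. (1 - ?q k) * \<phi> k x)"
      by (simp add: overlap_density_def sum_subtractf left_diff_distrib)
    then have "dist x p * (1 - overlap_density \<alpha> \<beta> \<phi> X x) = ?g x + (\<Sum>k\<in>X. (1 - ?q k) * (dist x p * \<phi> k x))"
      by (simp only: distrib_left sum_distrib_left mult_ac)
    moreover have "(1 - ?q k) * (dist x p * \<phi> k x) \<le> (1 - ?q k) * R * \<phi> k x" if k: "k \<in> X" for k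
    proof -
      have "dist x p * \<phi> k x \<le> R * \<phi> k x"
        using support_dist[OF k, of x] nonneg[OF k, of x] by (cases "\<phi> k x = 0") (auto intro: mult_right_mono)
      then have "(1 - ?q k) * (dist x p * \<phi> k x) \<le> (1 - ?q k) * (R * \<phi> k x)"
        using overlap_quotient(2)[OF AB k] by (intro mult_left_mono) auto
      then show ?thesis by (simp add: mult.assoc)
    qed
    ultimately show ?thesis by (simp add: sum_mono)
  qed
  have sum0: "0 \<le> (\<Sum>k\<in>X. \<phi> k x)" for x by (intro sum_nonneg nonneg)
  have g0: "0 \<le> ?g x" for x using sum_le_1[of x] by simp
  have h0: "0 \<le> ?h x" for x
    using overlap_quotient(2)[OF AB] R nonneg by (intro sum_nonneg mult_nonneg_nonneg) auto
  have gi: "integrable \<alpha> ?g"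
  proof (rule Bochner_Integration.integrable_bound[OF int])
    have "\<bar>?g x\<bar> \<le> \<bar>dist x p\<bar>" for x
      using sum0[of x] sum_le_1[of x] by (simp add: abs_mult mult_left_le_one_le)
    then show "AE x in \<alpha>. norm (?g x) \<le> norm (dist x p)" by simp
  qed measurable
  have hi: "integrable \<alpha> ?h"
    by (intro Bochner_Integration.integrable_sum integrable_mult_right integrable_part[OF AB])
  have "(\<integral>\<^sup>+x. ennreal (dist x p) * ennreal (1 - overlap_density \<alpha> \<beta> \<phi> X x) \<partial>\<alpha>)
      \<le> (\<integral>\<^sup>+x. ennreal (?g x + ?h x) \<partial>\<alpha>)"
    using pw overlap_density_bounds[OF AB]
    by (intro nn_integral_mono) (simp add: ennreal_mult[symmetric] ennreal_leI)
  also have "\<dots> = ennreal (\<integral>x. ?g x + ?h x \<partial>\<alpha>)"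
    using gi hi g0 h0 by (intro nn_integral_eq_integral) auto
  also have "(\<integral>x. ?g x + ?h x \<partial>\<alpha>) = (\<integral>x. ?g x \<partial>\<alpha>) + (\<integral>x. ?h x \<partial>\<alpha>)"
    using gi hi by (rule Bochner_Integration.integral_add)
  also have "(\<integral>x. ?h x \<partial>\<alpha>) = (\<Sum>k\<in>X. (1 - ?q k) * R * ?a k)"
    by (subst Bochner_Integration.integral_sum) (intro integrable_mult_right integrable_part[OF AB], auto)
  also have "\<dots> = R * (\<Sum>k\<in>X. ?a k - overlap \<alpha> \<beta> \<phi> k)"
    unfolding sum_distrib_left
  proof (rule sum.cong[OF refl])
    fix k assume k: "k \<in> X"
    have "(1 - ?q k) * R * ?a k = R * (?a k - ?q k * ?a k)" by (simp add: algebra_simps)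
    then show "(1 - ?q k) * R * ?a k = R * (?a k - overlap \<alpha> \<beta> \<phi> k)"
      by (simp only: overlap_quotient(3)[OF AB k])
  qed
  also have "\<dots> \<le> R * (\<Sum>k\<in>X. \<bar>?a k - ?b k\<bar>)"
    using R by (intro mult_left_mono sum_mono) (auto simp: overlap_def)
  finally show ?thesis by (simp add: ennreal_leI)
qed

text \<open>The matched density is nonzero only where \<open>x\<close> and \<open>y\<close> lie in
  the support of a common \<open>\<phi> k\<close>, hence within distance \<open>e\<close>. The
  leftover cost is estimated once for each marginal, whence the factor 2.\<close>

lemma W1_dist_le:
  fixes \<alpha> \<beta> :: "'a measure"
  assumes \<alpha>: "\<alpha> \<in> radon_probs" and \<beta>: "\<beta> \<in> radon_probs"
    and int: "integrable \<alpha> (\<lambda>x. dist x p)" "integrable \<beta> (\<lambda>x. dist x p)"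
  shows "W1_dist \<alpha> \<beta> \<le> ennreal (e + (\<integral>x. (1 - (\<Sum>k\<in>X. \<phi> k x)) * dist x p \<partial>\<alpha>)
    + (\<integral>x. (1 - (\<Sum>k\<in>X. \<phi> k x)) * dist x p \<partial>\<beta>)
    + 2 * R * (\<Sum>k\<in>X. \<bar>(\<integral>x. \<phi> k x \<partial>\<alpha>) - (\<integral>x. \<phi> k x \<partial>\<beta>)\<bar>))"
proof -
  have AB: "prob_space \<alpha>" "sets \<alpha> = sets borel" "prob_space \<beta>" "sets \<beta> = sets borel"
    using \<alpha> \<beta> by (auto simp: radon_probs_def radon_measure_def)
  note BA = AB(3,4,1,2)
  note [measurable] = matched_density_measurable[OF AB] leftover_density_measurable[OF AB]
  have "W1_dist \<alpha> \<beta> \<le> ennreal e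
      + (\<integral>\<^sup>+x. ennreal (dist x p) * ennreal (1 - overlap_density \<alpha> \<beta> \<phi> X x) \<partial>\<alpha>)
      + (\<integral>\<^sup>+x. ennreal (dist x p) * ennreal (1 - overlap_density \<beta> \<alpha> \<phi> X x) \<partial>\<beta>)"
  proof (rule W1_dist_le_split_density[OF \<alpha> \<beta>])
    show "(\<lambda>(x, y). ennreal (matched_density \<alpha> \<beta> \<phi> X x y)) \<in> borel_measurable (borel \<Otimes>\<^sub>M borel)"
      by measurable
    show "(\<lambda>(x, y). ennreal (leftover_density \<alpha> \<beta> \<phi> X x y)) \<in> borel_measurable (borel \<Otimes>\<^sub>M borel)"
      by measurable
    show "AE y in \<beta>. (\<integral>\<^sup>+x. ennreal (matched_density \<alpha> \<beta> \<phi> X x y) + ennreal (leftover_density \<alpha> \<beta> \<phi> X x y) \<partial>\<alpha>) = 1"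
      using nn_integral_matched_leftover[OF BA]
      by (simp add: matched_density_commute[of \<beta> \<alpha>] leftover_density_commute[of \<beta> \<alpha>])
    show "(\<integral>\<^sup>+x. ennreal (leftover_density \<alpha> \<beta> \<phi> X x y) \<partial>\<alpha>) \<le> ennreal (1 - overlap_density \<beta> \<alpha> \<phi> X y)" for y
      using nn_integral_leftover_density[OF BA, of y] by (simp add: leftover_density_commute[of \<beta> \<alpha>])
    show "dist x y \<le> e" if "ennreal (matched_density \<alpha> \<beta> \<phi> X x y) \<noteq> 0" for x y
    proof -
      have "matched_density \<alpha> \<beta> \<phi> X x y \<noteq> 0" using that by auto
      then obtain k where "k \<in> X" "\<phi> k x * \<phi> k y \<noteq> 0"
        unfolding matched_density_def by (metis (no_types, lifting) mult_zero_right sum.neutral)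
      then show ?thesis using support_diam by simp
    qed
  qed (use nn_integral_matched_leftover[OF AB] nn_integral_leftover_density[OF AB] e in auto)
  also have "\<dots> \<le> ennreal e + ennreal ((\<integral>x. (1 - (\<Sum>k\<in>X. \<phi> k x)) * dist x p \<partial>\<alpha>)
        + R * (\<Sum>k\<in>X. \<bar>(\<integral>x. \<phi> k x \<partial>\<alpha>) - (\<integral>x. \<phi> k x \<partial>\<beta>)\<bar>))
      + ennreal ((\<integral>x. (1 - (\<Sum>k\<in>X. \<phi> k x)) * dist x p \<partial>\<beta>)
        + R * (\<Sum>k\<in>X. \<bar>(\<integral>x. \<phi> k x \<partial>\<beta>) - (\<integral>x. \<phi> k x \<partial>\<alpha>)\<bar>))"
    by (intro add_mono order_refl nn_integral_dist_leftover_le AB int)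
  also have "\<dots> = ennreal (e + (\<integral>x. (1 - (\<Sum>k\<in>X. \<phi> k x)) * dist x p \<partial>\<alpha>)
    + (\<integral>x. (1 - (\<Sum>k\<in>X. \<phi> k x)) * dist x p \<partial>\<beta>)
    + 2 * R * (\<Sum>k\<in>X. \<bar>(\<integral>x. \<phi> k x \<partial>\<alpha>) - (\<integral>x. \<phi> k x \<partial>\<beta>)\<bar>))"
    using e R sum_le_1
    by (simp add: ennreal_plus[symmetric] sum_nonneg integral_nonneg_AE abs_minus_commute
        del: ennreal_plus)
  finally show ?thesis .
qed

end

section \<open>Integrability and compactness\<close>

lemma dist_measurable [measurable]: "(\<lambda>x. dist x p) \<in> borel_measurable borel"
  by (intro borel_measurable_continuous_onI continuous_intros)

text \<open>Marginals as image measures let integrals in one variable be pulled back to the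
  coupling.\<close>

lemma couplings_distr:
  assumes "\<pi> \<in> couplings \<alpha> \<beta>" "sets \<alpha> = sets borel" "sets \<beta> = sets borel"
  shows "distr \<pi> borel fst = \<alpha>" "distr \<pi> borel snd = \<beta>" "sets \<pi> = sets borel" "prob_space \<pi>"
proof -
  show s: "sets \<pi> = sets borel" and "prob_space \<pi>"
    using assms(1) by (auto simp: couplings_def radon_probs_def radon_measure_def)
  have sp: "space \<pi> = UNIV" using sets_eq_imp_space_eq[OF s] by simp
  have m: "fst \<in> \<pi> \<rightarrow>\<^sub>M borel" "snd \<in> \<pi> \<rightarrow>\<^sub>M borel"
    using fst_measurable_borel snd_measurable_borel by (simp_all add: measurable_cong_sets[OF s refl])
  show "distr \<pi> borel fst = \<alpha>" "distr \<pi> borel snd = \<beta>"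
    using assms m
    by (auto intro!: measure_eqI simp: emeasure_distr couplings_def sp vimage_fst vimage_snd)
qed

text \<open>A coupling with the Dirac measure at \<open>q\<close> is concentrated on
  \<open>snd z = q\<close>, so its cost is the integral of the distance to \<open>q\<close>. The
  triangle inequality replaces \<open>q\<close> by any \<open>p\<close>.\<close>

lemma W1_space_integrable_dist:
  assumes "\<alpha> \<in> W1_space"
  shows "integrable \<alpha> (\<lambda>x. dist x p)"
proof -
  from assms obtain q where \<alpha>: "\<alpha> \<in> radon_probs" and q: "W1_dist \<alpha> (return borel q) < \<infinity>"
    by (auto simp: W1_space_def)
  interpret A: prob_space \<alpha> using \<alpha> by (simp add: radon_probs_def)
  have s [measurable_cong]: "sets \<alpha> = sets borel" using \<alpha> by (simp add: radon_probs_def radon_measure_def)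
  from q obtain \<pi> where \<pi>: "\<pi> \<in> couplings \<alpha> (return borel q)"
      "(\<integral>\<^sup>+z. ennreal (dist (fst z) (snd z)) \<partial>\<pi>) < \<infinity>"
    unfolding W1_dist_def by (auto simp: INF_less_iff)
  note c = couplings_distr[OF \<pi>(1) s sets_return]
  note [measurable_cong] = c(3)
  have "AE x in distr \<pi> borel snd. x = q"
    unfolding c(2) by (subst AE_return) auto
  then have "AE z in \<pi>. snd z = q"
    by (subst (asm) AE_distr_iff) auto
  then have "(\<integral>\<^sup>+z. ennreal (dist (fst z) (snd z)) \<partial>\<pi>) = (\<integral>\<^sup>+z. ennreal (dist (fst z) q) \<partial>\<pi>)"
    by (intro nn_integral_cong_AE) auto
  also have "\<dots> = (\<integral>\<^sup>+x. ennreal (dist x q) \<partial>distr \<pi> borel fst)"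
    by (subst nn_integral_distr) auto
  finally have "(\<integral>\<^sup>+x. ennreal (dist x q) \<partial>\<alpha>) < \<infinity>" using \<pi>(2) by (simp add: c(1))
  then have "integrable \<alpha> (\<lambda>x. dist x q)"
    by (intro integrableI_nonneg) auto
  then have "integrable \<alpha> (\<lambda>x. dist x q + dist p q)" by simp
  then show ?thesis
    by (rule Bochner_Integration.integrable_bound) (auto intro!: AE_I2 dist_triangle2)
qed

lemma W1_space_radon_probs: "\<alpha> \<in> W1_space \<Longrightarrow> \<alpha> \<in> radon_probs"
  by (simp add: W1_space_def)

lemma W1_space_sets: "\<alpha> \<in> W1_space \<Longrightarrow> sets \<alpha> = sets borel"
  by (simp add: W1_space_def radon_probs_def radon_measure_def)

lemma W1_space_prob_space: "\<alpha> \<in> W1_space \<Longrightarrow> prob_space \<alpha>"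
  by (simp add: W1_space_def radon_probs_def)

lemma W1_space_integrable_MeC:
  assumes \<alpha>: "\<alpha> \<in> W1_space" and f: "continuous_on UNIV f" "f \<in> MeC"
  shows "integrable \<alpha> f"
proof -
  interpret prob_space \<alpha> using \<alpha> by (rule W1_space_prob_space)
  obtain a b p where ab: "a > 0" "b > 0" "\<And>x. \<bar>f x\<bar> \<le> a * dist x p + b"
    using f(2) by (auto simp: MeC_def)
  have "integrable \<alpha> (\<lambda>x. a * dist x p + b)"
    using W1_space_integrable_dist[OF \<alpha>, of p] by simp
  then show ?thesis
  proof (rule Bochner_Integration.integrable_bound)
    show "f \<in> borel_measurable \<alpha>"
      using borel_measurable_continuous_onI[OF f(1)]
      by (simp add: measurable_cong_sets[OF W1_space_sets[OF \<alpha>] refl])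
    show "AE x in \<alpha>. norm (f x) \<le> norm (a * dist x p + b)"
      using ab by (intro AE_I2) (smt (verit) real_norm_def)
  qed
qed

text \<open>Dominated convergence along a compact exhaustion.\<close>

lemma radon_compact_integral_tail:
  fixes g :: "'a::metric_space \<Rightarrow> real"
  assumes \<nu>: "\<nu> \<in> radon_probs" and g: "integrable \<nu> g" and e: "e > 0"
  obtains K where "compact K" "\<bar>\<integral>x. indicator (- K) x * g x \<partial>\<nu>\<bar> < e"
proof -
  have s [measurable_cong]: "sets \<nu> = sets borel"
    using \<nu> by (simp add: radon_probs_def radon_measure_def)
  obtain K where K: "\<And>n. compact (K n)" "incseq K" "AE x in \<nu>. x \<in> (\<Union>n. K n)"
    using \<nu> radon_measure_compact_exhaustion[of \<nu>] by (auto simp: radon_probs_def)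
  have [measurable]: "K n \<in> sets borel" for n using K(1) by (simp add: compact_imp_closed)
  have "(\<lambda>n. \<integral>x. indicator (- K n) x * g x \<partial>\<nu>) \<longlonglongrightarrow> (\<integral>x. 0 \<partial>\<nu>)"
  proof (rule integral_dominated_convergence[where w = "\<lambda>x. \<bar>g x\<bar>"])
    show "(\<lambda>x. indicator (- K n) x * g x) \<in> borel_measurable \<nu>" for n using g by measurable
    show "integrable \<nu> (\<lambda>x. \<bar>g x\<bar>)" using g by simp
    show "AE x in \<nu>. norm (indicator (- K n) x * g x) \<le> \<bar>g x\<bar>" for n
      by (auto simp: indicator_def)
    show "AE x in \<nu>. (\<lambda>n. indicator (- K n) x * g x) \<longlonglongrightarrow> 0"
      using K(3)
    proof eventually_elim
      case (elim x)
      then obtain m where "x \<in> K m" by auto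
      then have "x \<in> K n" if "n \<ge> m" for n using K(2) that by (auto simp: incseq_def)
      then have "\<forall>\<^sub>F n in sequentially. indicator (- K n) x * g x = 0"
        unfolding eventually_sequentially by (intro exI[of _ m]) simp
      then show ?case by (rule tendsto_eventually)
    qed
  qed simp
  then have "(\<lambda>n. \<bar>\<integral>x. indicator (- K n) x * g x \<partial>\<nu>\<bar>) \<longlonglongrightarrow> 0"
    by (simp add: tendsto_rabs_zero)
  then have "\<forall>\<^sub>F n in sequentially. \<bar>\<integral>x. indicator (- K n) x * g x \<partial>\<nu>\<bar> < e"
    using e order_tendstoD(2) by blast
  then obtain n where "\<bar>\<integral>x. indicator (- K n) x * g x \<partial>\<nu>\<bar> < e"
    by (auto simp: eventually_sequentially)
  then show thesis using that K(1) by blast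
qed

text \<open>Only \<open>y\<close> is confined to the compact set, so this is more than uniform
  continuity on \<open>K\<close>. Counterexamples at scales 1 / (n + 1) would have a subsequence
  along which both points tend to the same \<open>l\<close> in \<open>K\<close>, against continuity
  at \<open>l\<close>.\<close>

lemma compact_uniform_continuity_nearby:
  fixes f :: "'a::metric_space \<Rightarrow> 'b::metric_space"
  assumes f: "continuous_on UNIV f" and K: "compact K" and e: "e > 0"
  obtains d where "d > 0" "\<And>x y. y \<in> K \<Longrightarrow> dist x y < d \<Longrightarrow> dist (f x) (f y) < e"
proof -
  have "\<exists>d>0. \<forall>y\<in>K. \<forall>x. dist x y < d \<longrightarrow> dist (f x) (f y) < e"
  proof (rule ccontr)
    assume "\<not> ?thesis"
    then have "\<forall>n. \<exists>y x. y \<in> K \<and> dist x y < 1 / real (Suc n) \<and> \<not> dist (f x) (f y) < e"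
      by (metis of_nat_0_less_iff zero_less_Suc zero_less_divide_1_iff)
    then obtain y x where yx: "\<And>n. y n \<in> K" "\<And>n. dist (x n) (y n) < 1 / real (Suc n)"
        "\<And>n. \<not> dist (f (x n)) (f (y n)) < e"
      by metis
    obtain l r where l: "l \<in> K" "strict_mono r" "(y \<circ> r) \<longlonglongrightarrow> l"
      using seq_compactE[of K y] K yx(1) unfolding compact_eq_seq_compact_metric by metis
    have "(\<lambda>n. dist (x (r n)) (y (r n))) \<longlonglongrightarrow> 0"
    proof (rule tendsto_sandwich[OF _ _ tendsto_const LIMSEQ_Suc[OF lim_1_over_n]])
      show "\<forall>\<^sub>F n in sequentially. dist (x (r n)) (y (r n)) \<le> 1 / real (Suc n)"
      proof (intro always_eventually allI)
        fix n
        have "1 / real (Suc (r n)) \<le> 1 / real (Suc n)"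
          using seq_suble[OF l(2), of n] by (simp add: frac_le)
        then show "dist (x (r n)) (y (r n)) \<le> 1 / real (Suc n)"
          using yx(2)[of "r n"] by simp
      qed
    qed simp
    moreover have yl: "(\<lambda>n. y (r n)) \<longlonglongrightarrow> l" using l(3) by (simp add: o_def)
    ultimately have sum: "(\<lambda>n. dist (x (r n)) (y (r n)) + dist (y (r n)) l) \<longlonglongrightarrow> 0"
      by (intro tendsto_add_zero) (simp_all add: tendsto_dist_iff[symmetric])
    have "(\<lambda>n. dist (x (r n)) l) \<longlonglongrightarrow> 0"
      by (rule tendsto_sandwich[OF _ _ tendsto_const sum])
        (intro always_eventually allI zero_le_dist dist_triangle)+
    then have xl: "(\<lambda>n. x (r n)) \<longlonglongrightarrow> l"
      by (rule tendsto_dist_iff[THEN iffD2])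
    have c: "isCont f l" using f by (simp add: continuous_on_eq_continuous_at)
    have "(\<lambda>n. dist (f (x (r n))) (f (y (r n)))) \<longlonglongrightarrow> dist (f l) (f l)"
      by (intro tendsto_dist isCont_tendsto_compose[OF c] xl yl)
    then have "\<forall>\<^sub>F n in sequentially. dist (f (x (r n))) (f (y (r n))) < e"
      using e order_tendstoD(2)[of _ 0 _ e] by simp
    then show False using yx(3) by (auto simp: eventually_sequentially)
  qed
  then show thesis using that by blast
qed

text \<open>Tent functions of radius \<open>e\<close> about the points of a finite net of mesh e /
  2, normalised.\<close>

lemma compact_finite_subpartition_of_unity:
  fixes K :: "'a::metric_space set"
  assumes K: "compact K" and e: "e > 0"
  obtains X and \<phi> :: "'a \<Rightarrow> 'a \<Rightarrow> real" where "finite X" "\<And>k. continuous_on UNIV (\<phi> k)"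
    "\<And>k x. 0 \<le> \<phi> k x" "\<And>k x. \<phi> k x \<noteq> 0 \<Longrightarrow> dist x k < e"
    "\<And>x. (\<Sum>k\<in>X. \<phi> k x) \<le> 1" "\<And>x. x \<in> K \<Longrightarrow> (\<Sum>k\<in>X. \<phi> k x) = 1"
proof -
  have "\<exists>X. finite X \<and> K \<subseteq> (\<Union>k\<in>X. ball k (e / 2))"
    using K e unfolding compact_eq_totally_bounded by simp
  then obtain X where X: "finite X" "K \<subseteq> (\<Union>k\<in>X. ball k (e / 2))" by (elim exE conjE)
  define \<psi> where "\<psi> k x = max 0 (e - dist x k)" for k x :: 'a
  \<comment> \<open>The bound e / 2 keeps the denominator positive everywhere. On \<open>K\<close>
    some tent already reaches e / 2, so there the denominator is the sum itself.\<close>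
  define \<phi> where "\<phi> k x = \<psi> k x / max (e / 2) (\<Sum>k\<in>X. \<psi> k x)" for k x
  have \<psi>: "0 \<le> \<psi> k x" for k x by (simp add: \<psi>_def)
  have pos: "max (e / 2) (\<Sum>k\<in>X. \<psi> k x) > 0" for x using e by simp
  have c\<psi>: "continuous_on UNIV (\<psi> k)" for k
    unfolding \<psi>_def by (intro continuous_intros)
  have sum: "(\<Sum>k\<in>X. \<phi> k x) = (\<Sum>k\<in>X. \<psi> k x) / max (e / 2) (\<Sum>k\<in>X. \<psi> k x)" for x
    by (simp add: \<phi>_def sum_divide_distrib)
  show thesis
  proof
    show "finite X" by fact
    show "continuous_on UNIV (\<phi> k)" for k
      unfolding \<phi>_def using c\<psi> pos
      by (intro continuous_on_divide continuous_on_max continuous_on_sum continuous_on_const)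
         (auto simp: less_le)
    show "0 \<le> \<phi> k x" for k x using \<psi> pos[of x] by (simp add: \<phi>_def)
    show "dist x k < e" if "\<phi> k x \<noteq> 0" for k x
      using that by (auto simp: \<phi>_def \<psi>_def max_def split: if_splits)
    show "(\<Sum>k\<in>X. \<phi> k x) \<le> 1" for x using pos[of x] by (simp add: sum divide_le_eq_1)
    show "(\<Sum>k\<in>X. \<phi> k x) = 1" if "x \<in> K" for x
    proof -
      obtain k where k: "k \<in> X" "dist x k < e / 2"
        using subsetD[OF X(2) \<open>x \<in> K\<close>] by (auto simp: dist_commute)
      then have "e / 2 \<le> \<psi> k x" by (simp add: \<psi>_def max_def)
      also have "\<dots> \<le> (\<Sum>k\<in>X. \<psi> k x)" using k X(1) \<psi> by (intro member_le_sum) auto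
      finally show ?thesis using e by (simp add: sum max_def)
    qed
  qed
qed

section \<open>The two implications\<close>

lemma W1_converges_imp_integral_tendsto:
  fixes \<mu> :: "nat \<Rightarrow> 'a::metric_space measure"
  assumes \<mu>: "\<And>i. \<mu> i \<in> W1_space" and \<nu>: "\<nu> \<in> W1_space" and conv: "W1_converges \<mu> \<nu>"
    and f: "continuous_on UNIV f" "f \<in> MeC"
  shows "(\<lambda>i. \<integral>x. f x \<partial>\<mu> i) \<longlonglongrightarrow> (\<integral>x. f x \<partial>\<nu>)"
proof (rule tendstoI)
  fix e :: real assume e: "e > 0"
  obtain a b p where ab: "a > 0" "b > 0" "\<And>x. \<bar>f x\<bar> \<le> a * dist x p + b"
    using f(2) by (auto simp: MeC_def)
  \<comment> \<open>The factor 2 arises from bounding \<open>f x\<close> and \<open>f y\<close>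
    separately: the triangle inequality gives \<open>a * dist x y + g y\<close>.\<close>
  define g where "g x = 2 * (a * dist x p + b)" for x
  have [measurable]: "g \<in> borel_measurable borel" unfolding g_def by measurable
  have [measurable]: "f \<in> borel_measurable borel" using f(1) by (rule borel_measurable_continuous_onI)
  interpret N: prob_space \<nu> using \<nu> by (rule W1_space_prob_space)
  have "integrable \<nu> g" unfolding g_def using W1_space_integrable_dist[OF \<nu>, of p] by simp
  then obtain K where K: "compact K" "\<bar>\<integral>x. indicator (- K) x * g x \<partial>\<nu>\<bar> < e / 3"
    by (rule radon_compact_integral_tail[OF W1_space_radon_probs[OF \<nu>], of g "e / 3"]) (use e in simp_all)
  obtain d where d: "d > 0" "\<And>x y. y \<in> K \<Longrightarrow> dist x y < d \<Longrightarrow> dist (f x) (f y) < e / 3"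
    by (rule compact_uniform_continuity_nearby[OF f(1) K(1), of "e / 3"]) (use e in simp_all)
  obtain R where R: "R > 0" "\<And>y. y \<in> K \<Longrightarrow> g y \<le> R"
  proof -
    obtain r where r: "\<forall>y\<in>K. dist p y \<le> r"
      using compact_imp_bounded[OF K(1)] unfolding bounded_any_center[of K p] by (rule exE)
    have "0 < a * max r 0 + b" using ab by (simp add: add_nonneg_pos)
    moreover have "g y \<le> 2 * (a * max r 0 + b)" if "y \<in> K" for y
      using ab r that by (force simp: g_def dist_commute)
    ultimately show thesis by (intro that[of "2 * (a * max r 0 + b)"]) auto
  qed
  \<comment> \<open>The slope \<open>a\<close> is for \<open>y\<close> outside \<open>K\<close>;
    \<open>R / d\<close> absorbs \<open>g y \<le> R\<close> when \<open>y\<close> is in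
    \<open>K\<close> and \<open>dist x y \<ge> d\<close>.\<close>
  define C where "C = a + R / d"
  have C: "C > 0" using ab R d by (simp add: C_def add_pos_pos)
  have pw: "\<bar>f x - f y\<bar> \<le> e / 3 + C * dist x y + indicator (- K) y * g y" for x y
  proof -
    have tri: "\<bar>f x - f y\<bar> \<le> a * dist x y + g y"
    proof -
      have "a * dist x p \<le> a * (dist x y + dist y p)"
        using ab by (intro mult_left_mono dist_triangle) auto
      then show ?thesis using ab(3)[of x] ab(3)[of y] by (simp add: g_def algebra_simps)
    qed
    consider "y \<notin> K" | "y \<in> K" "dist x y < d" | "y \<in> K" "dist x y \<ge> d" by linarith
    then show ?thesis
    proof cases
      case 1
      have "a * dist x y \<le> C * dist x y" using R d by (intro mult_right_mono) (auto simp: C_def)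
      then show ?thesis using 1 tri e by simp
    next
      case 2
      moreover have "0 \<le> C * dist x y" using C by simp
      ultimately show ?thesis using d(2)[of y x] by (simp add: dist_real_def)
    next
      case 3
      have "g y \<le> R / d * d" using R(2)[OF 3(1)] d by simp
      also have "\<dots> \<le> R / d * dist x y" using 3 R d by (intro mult_left_mono) auto
      finally show ?thesis using 3 tri e by (simp add: C_def algebra_simps)
    qed
  qed
  \<comment> \<open>This threshold makes the term with slope \<open>C\<close> contribute less than e
    / 3.\<close>
  have "\<forall>\<^sub>F i in sequentially. W1_dist (\<mu> i) \<nu> < ennreal (e / (3 * C))"
    using conv e C unfolding W1_converges_def by (intro order_tendstoD(2)[of _ 0]) auto
  then show "\<forall>\<^sub>F i in sequentially. dist (\<integral>x. f x \<partial>\<mu> i) (\<integral>x. f x \<partial>\<nu>) < e"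
  proof eventually_elim
    case (elim i)
    from elim obtain \<pi> where \<pi>: "\<pi> \<in> couplings (\<mu> i) \<nu>"
        "(\<integral>\<^sup>+z. ennreal (dist (fst z) (snd z)) \<partial>\<pi>) < ennreal (e / (3 * C))"
      unfolding W1_dist_def by (auto simp: INF_less_iff)
    note c = couplings_distr[OF \<pi>(1) W1_space_sets[OF \<mu>] W1_space_sets[OF \<nu>]]
    note [measurable_cong] = c(3)
    interpret P: prob_space \<pi> by (rule c(4))
    have m [measurable]: "(\<lambda>z. dist (fst z) (snd z)) \<in> borel_measurable \<pi>"
      unfolding measurable_cong_sets[OF c(3) refl]
      by (intro borel_measurable_continuous_onI continuous_intros)
    have [measurable]: "K \<in> sets borel" using K(1) by (simp add: compact_imp_closed)
    have int: "integrable \<pi> (\<lambda>z. dist (fst z) (snd z))"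
      using \<pi>(2) by (intro integrableI_nonneg) (auto intro: less_trans simp: less_top[symmetric])
    have "ennreal (\<integral>z. dist (fst z) (snd z) \<partial>\<pi>) < ennreal (e / (3 * C))"
      using \<pi>(2) by (subst nn_integral_eq_integral[symmetric]) (use int in auto)
    then have d_le: "(\<integral>z. dist (fst z) (snd z) \<partial>\<pi>) < e / (3 * C)"
      by (subst (asm) ennreal_less_iff) (auto intro!: integral_nonneg_AE)
    have fi: "integrable \<pi> (\<lambda>z. f (fst z))" "(\<integral>x. f x \<partial>\<mu> i) = (\<integral>z. f (fst z) \<partial>\<pi>)"
      using W1_space_integrable_MeC[OF \<mu> f, of i]
      by (simp_all add: c(1)[symmetric] integrable_distr_eq integral_distr)
    have fn: "integrable \<pi> (\<lambda>z. f (snd z))" "(\<integral>x. f x \<partial>\<nu>) = (\<integral>z. f (snd z) \<partial>\<pi>)"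
      using W1_space_integrable_MeC[OF \<nu> f]
      by (simp_all add: c(2)[symmetric] integrable_distr_eq integral_distr)
    have "integrable \<nu> (\<lambda>x. indicator (- K) x * g x)"
      using integrable_real_mult_indicator[of "- K" \<nu> g] \<open>integrable \<nu> g\<close> W1_space_sets[OF \<nu>]
      by (simp add: mult.commute borel_comp)
    then have gn: "integrable \<pi> (\<lambda>z. indicator (- K) (snd z) * g (snd z))"
        "(\<integral>x. indicator (- K) x * g x \<partial>\<nu>) = (\<integral>z. indicator (- K) (snd z) * g (snd z) \<partial>\<pi>)"
      by (simp_all add: c(2)[symmetric] integrable_distr_eq integral_distr)
    have "dist (\<integral>x. f x \<partial>\<mu> i) (\<integral>x. f x \<partial>\<nu>) = \<bar>\<integral>z. f (fst z) - f (snd z) \<partial>\<pi>\<bar>"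
      using fi fn by (simp add: dist_real_def)
    also have "\<dots> \<le> (\<integral>z. \<bar>f (fst z) - f (snd z)\<bar> \<partial>\<pi>)" by (rule integral_abs_bound)
    also have "\<dots> \<le> (\<integral>z. e / 3 + C * dist (fst z) (snd z) + indicator (- K) (snd z) * g (snd z) \<partial>\<pi>)"
      using fi(1) fn(1) int gn(1) pw by (intro integral_mono) auto
    also have "\<dots> = e / 3 + C * (\<integral>z. dist (fst z) (snd z) \<partial>\<pi>) + (\<integral>x. indicator (- K) x * g x \<partial>\<nu>)"
      using int gn by (simp add: P.prob_space)
    also have "\<dots> < e / 3 + e / 3 + e / 3"
    proof -
      have "C * (\<integral>z. dist (fst z) (snd z) \<partial>\<pi>) < e / 3"
        using mult_strict_left_mono[OF d_le C] C by simp
      then show ?thesis using K(2) by simp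
    qed
    finally show ?case by simp
  qed
qed

lemma integral_tendsto_imp_W1_converges:
  fixes \<mu> :: "nat \<Rightarrow> 'a::metric_space measure"
  assumes \<mu>: "\<And>i. \<mu> i \<in> W1_space" and \<nu>: "\<nu> \<in> W1_space"
    and conv: "\<And>f. continuous_on UNIV f \<Longrightarrow> f \<in> MeC \<Longrightarrow> (\<lambda>i. \<integral>x. f x \<partial>\<mu> i) \<longlonglongrightarrow> (\<integral>x. f x \<partial>\<nu>)"
  shows "W1_converges \<mu> \<nu>"
  unfolding W1_converges_def
proof (rule order_tendstoI)
  fix c :: ennreal assume "0 < c"
  \<comment> \<open>\<open>c\<close> may be infinite, so a positive real below it takes its
    place.\<close>
  then obtain e :: real where e: "e > 0" and ec: "ennreal e < c"
    by (metis dense ennreal_cases ennreal_less_zero_iff not_less_iff_gr_or_eq top_greatest linorder_not_le)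
  from e have e8: "e / 8 > 0" by simp
  fix p :: 'a
  interpret N: prob_space \<nu> using \<nu> by (rule W1_space_prob_space)
  obtain K where K: "compact K" "\<bar>\<integral>x. indicator (- K) x * dist x p \<partial>\<nu>\<bar> < e / 8"
    by (rule radon_compact_integral_tail[OF W1_space_radon_probs[OF \<nu>] W1_space_integrable_dist[OF \<nu>], of "e / 8" p])
      (use e in simp_all)
  obtain X and \<phi> :: "'a \<Rightarrow> 'a \<Rightarrow> real" where \<phi>: "finite X" "\<And>k. continuous_on UNIV (\<phi> k)"
    "\<And>k x. 0 \<le> \<phi> k x" "\<And>k x. \<phi> k x \<noteq> 0 \<Longrightarrow> dist x k < e / 8"
    "\<And>x. (\<Sum>k\<in>X. \<phi> k x) \<le> 1" "\<And>x. x \<in> K \<Longrightarrow> (\<Sum>k\<in>X. \<phi> k x) = 1"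
    by (rule compact_finite_subpartition_of_unity[OF K(1) e8]) (rule that)
  \<comment> \<open>A crude bound for the distance from \<open>p\<close> to any support: all centre
    distances together, plus the radius of the supports.\<close>
  define R where "R = (\<Sum>k\<in>X. dist k p) + e / 8"
  \<comment> \<open>A continuous substitute for the distance to \<open>p\<close> cut off to the
    complement of \<open>K\<close>, so that the assumed convergence applies to it.\<close>
  let ?g = "\<lambda>x. (1 - (\<Sum>k\<in>X. \<phi> k x)) * dist x p"
  have [measurable]: "\<phi> k \<in> borel_measurable borel" for k
    using \<phi>(2) by (rule borel_measurable_continuous_onI)
  \<comment> \<open>Supports of radius e / 8 have diameter at most e / 4.\<close>
  interpret metric_subpartition_of_unity X \<phi> p R "e / 4"
  proof
    show "dist x p \<le> R" if "k \<in> X" "\<phi> k x \<noteq> 0" for k x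
    proof -
      have "dist k p \<le> (\<Sum>k\<in>X. dist k p)" using that \<phi>(1) by (intro member_le_sum) auto
      then show ?thesis
        using \<phi>(4)[OF that(2)] dist_triangle[of x p k] by (simp add: R_def)
    qed
    show "dist x y \<le> e / 4" if "k \<in> X" "\<phi> k x \<noteq> 0" "\<phi> k y \<noteq> 0" for k x y
      using \<phi>(4)[OF that(2)] \<phi>(4)[OF that(3)] dist_triangle2[of x y k] by simp
    show "0 \<le> R" using e by (simp add: R_def sum_nonneg)
  qed (use \<phi> e in auto)
  have sum0: "0 \<le> (\<Sum>k\<in>X. \<phi> k x)" for x by (intro sum_nonneg \<phi>(3))
  have g_le: "\<bar>?g x\<bar> \<le> indicator (- K) x * dist x p" for x
    using sum0[of x] sum_le_1[of x] \<phi>(6)[of x]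
    by (cases "x \<in> K") (auto simp: abs_mult mult_left_le_one_le)
  have g_cont: "continuous_on UNIV ?g" by (intro continuous_intros \<phi>(2))
  have g_MeC: "?g \<in> MeC"
  proof -
    have "\<bar>?g x\<bar> \<le> 1 * dist x p + 1" for x
      by (rule order_trans[OF g_le]) (simp add: indicator_def)
    then show ?thesis unfolding MeC_def mem_Collect_eq by (intro exI[of _ 1] exI[of _ p] conjI allI) auto
  qed
  have \<phi>_MeC: "\<phi> k \<in> MeC" if "k \<in> X" for k
  proof -
    have "\<bar>\<phi> k x\<bar> \<le> 1 * dist x p + 1" for x
      using le_1[OF that, of x] \<phi>(3)[of k x] zero_le_dist[of x p] by linarith
    then show ?thesis unfolding MeC_def mem_Collect_eq by (intro exI[of _ 1] exI[of _ p] conjI allI) auto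
  qed
  have [measurable]: "K \<in> sets borel" using K(1) by (simp add: compact_imp_closed)
  have Ki: "integrable \<nu> (\<lambda>x. indicator (- K) x * dist x p)"
    using integrable_real_mult_indicator[of "- K" \<nu> "\<lambda>x. dist x p"] W1_space_integrable_dist[OF \<nu>, of p]
      W1_space_sets[OF \<nu>]
    by (simp add: mult.commute borel_comp)
  have "(\<integral>x. ?g x \<partial>\<nu>) \<le> (\<integral>x. indicator (- K) x * dist x p \<partial>\<nu>)"
    using g_le by (intro integral_mono W1_space_integrable_MeC[OF \<nu> g_cont g_MeC] Ki) (meson abs_le_D1)
  then have g_small: "(\<integral>x. ?g x \<partial>\<nu>) < e / 8" using K(2) by simp
  define B where "B i = e / 4 + (\<integral>x. ?g x \<partial>\<mu> i) + (\<integral>x. ?g x \<partial>\<nu>)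
    + 2 * R * (\<Sum>k\<in>X. \<bar>(\<integral>x. \<phi> k x \<partial>\<mu> i) - (\<integral>x. \<phi> k x \<partial>\<nu>)\<bar>)" for i
  \<comment> \<open>The finite partition and \<open>R\<close> do not depend on \<open>i\<close>, so
    the differences vanish in the limit, which is below e / 4 + 2 * (e / 8) = e / 2.\<close>
  have "B \<longlonglongrightarrow> e / 4 + (\<integral>x. ?g x \<partial>\<nu>) + (\<integral>x. ?g x \<partial>\<nu>)
    + 2 * R * (\<Sum>k\<in>X. \<bar>(\<integral>x. \<phi> k x \<partial>\<nu>) - (\<integral>x. \<phi> k x \<partial>\<nu>)\<bar>)"
    unfolding B_def by (intro tendsto_intros conv g_cont g_MeC \<phi>(2) \<phi>_MeC)
  then have "\<forall>\<^sub>F i in sequentially. B i < e"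
    by (rule order_tendstoD(2)) (use g_small e in simp)
  then show "\<forall>\<^sub>F i in sequentially. W1_dist (\<mu> i) \<nu> < c"
  proof eventually_elim
    case (elim i)
    have "W1_dist (\<mu> i) \<nu> \<le> ennreal (B i)"
      unfolding B_def using \<mu>[of i] \<nu>
      by (intro W1_dist_le W1_space_integrable_dist) (auto simp: W1_space_def)
    also have "\<dots> \<le> ennreal e" using elim by (intro ennreal_leI) simp
    finally show ?case using ec by (rule le_less_trans)
  qed
\<comment> \<open>The lower half of \<open>order_tendstoI\<close> is void: no \<open>ennreal\<close>
  is below 0.\<close>
qed simp

theorem theorem2p10:
  fixes \<mu> :: "nat \<Rightarrow> 'a::metric_space measure" and \<nu> :: "'a measure"
  assumes "\<And>i. \<mu> i \<in> W1_space" and "\<nu> \<in> W1_space"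
  shows "W1_converges \<mu> \<nu> \<longleftrightarrow>
    (\<forall>f::'a \<Rightarrow> real. continuous_on UNIV f \<and> f \<in> MeC \<longrightarrow>
       (\<lambda>i. \<integral>x. f x \<partial>(\<mu> i)) \<longlonglongrightarrow> (\<integral>x. f x \<partial>\<nu>))"
proof (intro iffI allI impI)
  fix f :: "'a \<Rightarrow> real"
  assume "W1_converges \<mu> \<nu>" "continuous_on UNIV f \<and> f \<in> MeC"
  then show "(\<lambda>i. \<integral>x. f x \<partial>(\<mu> i)) \<longlonglongrightarrow> (\<integral>x. f x \<partial>\<nu>)"
    by (intro W1_converges_imp_integral_tendsto assms) simp_all
next
  assume "\<forall>f::'a \<Rightarrow> real. continuous_on UNIV f \<and> f \<in> MeC \<longrightarrow>
    (\<lambda>i. \<integral>x. f x \<partial>(\<mu> i)) \<longlonglongrightarrow> (\<integral>x. f x \<partial>\<nu>)"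
  then show "W1_converges \<mu> \<nu>"
    by (intro integral_tendsto_imp_W1_converges assms) simp_all
qed

end
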